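(* Let $(X,T)$ be a topological dynamical system which is saturated, let $r\ge 1$ and let $\Phi\in C(X^r)$. For $\alpha\in\mathbb{R}$ put $$E_\Phi(\alpha)=\Big\{x\in X:\ \lim_{n\to\infty} n^{-r}\sum_{1\le i_1,\dots,i_r\le n}\Phi(T^{i_1}x,\dots,T^{i_r}x)=\alpha\Big\},\qquad \mathcal{M}_\Phi(\alpha)=\Big\{\mu\in\mathcal{M}_{\rm inv}:\ \int_{X^r}\Phi\,d\mu^{\otimes r}=\alpha\Big\}.$$ If $\mathcal{M}_\Phi(\alpha)=\emptyset$, then $E_\Phi(\alpha)=\emptyset$. If $\mathcal{M}_\Phi(\alpha)\neq\emptyset$, then $$h_{\rm top}(E_\Phi(\alpha))=\sup_{\mu\in\mathcal{M}_\Phi(\alpha)}h_\mu .$$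
   Context: $X$ is a compact metric space with metric $d$ and $T:X\to X$ is continuous. $X^r=X\times\cdots\times X$ ($r$ copies), $C(X^r)$ is the space of real continuous functions on $X^r$, and $\mu^{\otimes r}=\mu\times\cdots\times\mu$ ($r$ copies). $\mathcal{M}_{\rm inv}$ is the set of $T$-invariant Borel probability measures on $X$ and $h_\mu$ the measure-theoretic entropy of $\mu$. Topological entropy of a set (Bowen): for $n\ge1$ let $d_n(x,y)=\max_{0\le j<n}d(T^jx,T^jy)$ and $B_n(x,\epsilon)$ the open $d_n$-ball of radius $\epsilon$ about $x$. For $Z\subset X$, $s\ge0$, $\epsilon>0$, let $H^s_n(Z,\epsilon)=\inf\sum_i e^{-sn_i}$, the infimum over all at most countable covers $\{B_{n_i}(x_i,\epsilon)\}$ of $Z$ with $\min_i n_i\ge n$; let $H^s(Z,\epsilon)=\lim_{n\to\infty}H^s_n(Z,\epsilon)$, let $h_{\rm top}(Z,\epsilon)$ be the critical value of $s$ at which $H^s(Z,\epsilon)$ jumps from $+\infty$ to $0$, and $h_{\rm top}(Z)=\lim_{\epsilon\to0}h_{\rm top}(Z,\epsilon)$. For $\mu\in\mathcal{M}_{\rm inv}$, the set of $\mu$-generic points is $G_\mu=\{x\in X: \frac1n\sum_{j=0}^{n-1}\delta_{T^jx}\to\mu$ weak-star$\}$. The system $(X,T)$ is called saturated if $h_{\rm top}(G_\mu)=h_\mu$ for every $\mu\in\mathcal{M}_{\rm inv}$. *)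

theory Defs
  imports "HOL-Probability.Probability"
begin

text \<open>Standing setting: X is a compact subset of a metric space (the compact metric
space of the paper), T maps X continuously into X.  Points of X^r are represented as
functions in PiE {..<r} (\<lambda>_. X) with the product topology.\<close>

definition invariant_measures :: "'a::metric_space set \<Rightarrow> ('a \<Rightarrow> 'a) \<Rightarrow> 'a measure set" where
  "invariant_measures X T =
     {\<mu>. sets \<mu> = sets (restrict_space borel X) \<and> prob_space \<mu> \<and>
          (\<forall>A\<in>sets \<mu>. emeasure \<mu> (T -` A \<inter> X) = emeasure \<mu> A)}"

definition meas_partition :: "'a measure \<Rightarrow> 'a set set \<Rightarrow> bool" where
  "meas_partition \<mu> P \<longleftrightarrow> finite P \<and> P \<subseteq> sets \<mu> \<and> disjoint P \<and> \<Union>P = space \<mu>"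

definition iter_join :: "'a set \<Rightarrow> ('a \<Rightarrow> 'a) \<Rightarrow> 'a set set \<Rightarrow> nat \<Rightarrow> 'a set set" where
  "iter_join X T P n = {{x\<in>X. \<forall>j<n. (T^^j) x \<in> w j} | w. w \<in> PiE {..<n} (\<lambda>_. P)}"

definition partition_entropy :: "'a measure \<Rightarrow> 'a set set \<Rightarrow> real" where
  "partition_entropy \<mu> P = - (\<Sum>A\<in>P. measure \<mu> A * ln (measure \<mu> A))"

definition entropy_rel :: "'a measure \<Rightarrow> ('a \<Rightarrow> 'a) \<Rightarrow> 'a set set \<Rightarrow> real" where
  "entropy_rel \<mu> T P = lim (\<lambda>n. partition_entropy \<mu> (iter_join (space \<mu>) T P n) / real n)"

definition ks_entropy :: "'a measure \<Rightarrow> ('a \<Rightarrow> 'a) \<Rightarrow> ereal" where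
  "ks_entropy \<mu> T = (SUP P\<in>{P. meas_partition \<mu> P}. ereal (entropy_rel \<mu> T P))"

definition bowen_ball :: "'a::metric_space set \<Rightarrow> ('a \<Rightarrow> 'a) \<Rightarrow> 'a \<Rightarrow> nat \<Rightarrow> real \<Rightarrow> 'a set" where
  "bowen_ball X T x n \<epsilon> = {y\<in>X. \<forall>j<n. dist ((T^^j) x) ((T^^j) y) < \<epsilon>}"

definition bowen_H_n :: "'a::metric_space set \<Rightarrow> ('a \<Rightarrow> 'a) \<Rightarrow> real \<Rightarrow> nat \<Rightarrow> 'a set \<Rightarrow> real \<Rightarrow> ennreal" where
  "bowen_H_n X T s n Z \<epsilon> =
     (INF (I, c, m)\<in>{(I :: nat set, c :: nat \<Rightarrow> 'a, m :: nat \<Rightarrow> nat).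
                      (\<forall>i\<in>I. c i \<in> X \<and> n \<le> m i) \<and> Z \<subseteq> (\<Union>i\<in>I. bowen_ball X T (c i) (m i) \<epsilon>)}.
        (\<Sum>i. if i \<in> I then ennreal (exp (- s * real (m i))) else 0))"

text \<open>H^s(Z,\<epsilon>) = lim_n H^s_n(Z,\<epsilon>); the sequence is nondecreasing in n, so the limit is the supremum.\<close>
definition bowen_H :: "'a::metric_space set \<Rightarrow> ('a \<Rightarrow> 'a) \<Rightarrow> real \<Rightarrow> 'a set \<Rightarrow> real \<Rightarrow> ennreal" where
  "bowen_H X T s Z \<epsilon> = (SUP n. bowen_H_n X T s n Z \<epsilon>)"

text \<open>Critical value: inf {s \<ge> 0. H^s(Z,\<epsilon>) = 0} (= sup {s. H^s = \<infinity>}).\<close>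
definition htop_eps :: "'a::metric_space set \<Rightarrow> ('a \<Rightarrow> 'a) \<Rightarrow> 'a set \<Rightarrow> real \<Rightarrow> ereal" where
  "htop_eps X T Z \<epsilon> = Inf (ereal ` {s. 0 \<le> s \<and> bowen_H X T s Z \<epsilon> = 0})"

text \<open>h_top(Z) = lim_{\<epsilon>\<to>0} h_top(Z,\<epsilon>); nonincreasing in \<epsilon>, so the limit is the supremum.\<close>
definition htop :: "'a::metric_space set \<Rightarrow> ('a \<Rightarrow> 'a) \<Rightarrow> 'a set \<Rightarrow> ereal" where
  "htop X T Z = (SUP \<epsilon>\<in>{0<..}. htop_eps X T Z \<epsilon>)"

definition generic_points :: "'a::metric_space set \<Rightarrow> ('a \<Rightarrow> 'a) \<Rightarrow> 'a measure \<Rightarrow> 'a set" where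
  "generic_points X T \<mu> =
     {x\<in>X. \<forall>f. continuous_on X f \<longrightarrow>
        (\<lambda>n. (\<Sum>j<n. f ((T^^j) x)) / real n) \<longlonglongrightarrow> integral\<^sup>L \<mu> (f :: 'a \<Rightarrow> real)}"

definition saturated :: "'a::metric_space set \<Rightarrow> ('a \<Rightarrow> 'a) \<Rightarrow> bool" where
  "saturated X T \<longleftrightarrow> (\<forall>\<mu>\<in>invariant_measures X T. htop X T (generic_points X T \<mu>) = ks_entropy \<mu> T)"

definition level_set_E :: "'a::metric_space set \<Rightarrow> ('a \<Rightarrow> 'a) \<Rightarrow> nat \<Rightarrow> ((nat \<Rightarrow> 'a) \<Rightarrow> real) \<Rightarrow> real \<Rightarrow> 'a set" where
  "level_set_E X T r \<Phi> \<alpha> =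
     {x\<in>X. (\<lambda>n. (\<Sum>i\<in>PiE {..<r} (\<lambda>_. {1..n}). \<Phi> (\<lambda>k\<in>{..<r}. (T^^(i k)) x)) / real n ^ r)
            \<longlonglongrightarrow> \<alpha>}"

definition level_measures :: "'a::metric_space set \<Rightarrow> ('a \<Rightarrow> 'a) \<Rightarrow> nat \<Rightarrow> ((nat \<Rightarrow> 'a) \<Rightarrow> real) \<Rightarrow> real \<Rightarrow> 'a measure set" where
  "level_measures X T r \<Phi> \<alpha> =
     {\<mu>\<in>invariant_measures X T. integral\<^sup>L (PiM {..<r} (\<lambda>_. \<mu>)) \<Phi> = \<alpha>}"

end

(* For the lower bound, the multiple averages of a generic point of \<mu> converge to the integral of \<Phi>
   against the product measure: by Stone-Weierstrass it suffices to take sums of products of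
   functions of one variable, for which the average factorizes. So level measures have their
   generic points in the level set, and saturation applies.

   Conversely, every x in the level set has a weak-star limit \<mu> of its empirical measures (Tychonoff
   and Riesz), and by the same argument \<mu> is a level measure. The upper bound is Bowen's theorem
   that a set of points having limit measures of entropy at most t has topological entropy at
   most t. Code orbits by a partition into small pieces with \<mu>-null boundary. For some block
   length m, the entropy of the m-blocks is below m (t + \<delta>), so infinitely often the average of
   - ln s(block) along the orbit of x is below m (t + \<delta>) for rational weights s close to the block
   distribution. As the weights sum to at most 1, only about exp(n (t + \<delta>)) itineraries of length
   n have this property, and there are only countably many choices of (m, s). *)
theory Submission
  imports Defs
begin

section \<open>Integration of continuous functions on a compact set\<close>

text \<open>The limit measure depends on the point, and so does a partition with null boundary;
  there may be uncountably many of both, while entropy is only controlled under countable unions.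
  What is kept fixed is therefore only the ball centres, a block length and rational weights, and
  the labelling of the space by centres stays existentially quantified. This is enough because two
  orbits close to the same sequence of centres are close to each other, whatever labellings produced
  that sequence. Bowen's definition admits covers by balls of varying lengths, so each point needs
  to be caught only at infinitely many times and the geometric tail of the costs does the rest;
  hence convergence along a filter finer than \<open>sequentially\<close> suffices. Replacing the
  block distribution by weights \<open>s\<close> turns an entropy into a Birkhoff average of
  \<open>- ln s\<close>, which is visible along a single orbit and can be counted by Markov's
  inequality.\<close>

lemma eventually_one_le_mult:
  fixes a :: real
  assumes "0 < a"
  shows "\<forall>\<^sub>F k in sequentially. 1 \<le> real k * a"
proof -
  obtain K where K: "1 / a < real K"
    using reals_Archimedean2 by blast
  show ?thesis
  proof (rule eventually_sequentiallyI)
    fix k assume "K \<le> k"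
    then have "1 / a \<le> real k"
      using K by linarith
    then show "1 \<le> real k * a"
      using assms by (simp add: field_simps)
  qed
qed

lemma eventually_one_le_mult_infdist:
  assumes "closed F" "F \<noteq> {}" "x \<notin> F"
  shows "\<forall>\<^sub>F k in sequentially. 1 \<le> real k * infdist x F"
  using assms by (intro eventually_one_le_mult) (simp add: infdist_pos_not_in_closed)

lemma integrable_continuous_on_compact:
  fixes f :: "'a::metric_space \<Rightarrow> real"
  assumes "compact X" "sets M = sets (restrict_space borel X)" "finite_measure M" "continuous_on X f"
  shows "f \<in> borel_measurable M" "integrable M f"
proof -
  interpret finite_measure M by fact
  have space: "space M = X"
    using sets_eq_imp_space_eq[OF assms(2)] by (simp add: space_restrict_space)
  show *: "f \<in> borel_measurable M"
    using borel_measurable_continuous_on_restrict[OF assms(4)] measurable_cong_sets[OF assms(2) refl]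
    by blast
  obtain B where "\<And>x. x \<in> X \<Longrightarrow> norm (f x) \<le> B"
    using compact_imp_bounded[OF compact_continuous_image[OF assms(4,1)]]
    by (auto simp: bounded_iff)
  then show "integrable M f"
    by (intro integrable_const_bound[of _ B] *) (auto simp: space intro!: AE_I2)
qed

text \<open>The relatively closed sets are an intersection-stable generator, and the indicator of a
  closed \<open>F\<close> is the limit of the continuous functions
  \<open>1 - k * infdist x F\<close> cut off at 0, so dominated convergence recovers measures of
  closed sets from integrals.\<close>

lemma measure_eqI_continuous:
  fixes X :: "'a::metric_space set"
  assumes X: "compact X"
    and M: "sets M = sets (restrict_space borel X)" "prob_space M"
    and N: "sets N = sets (restrict_space borel X)" "prob_space N"
    and eq: "\<And>f :: 'a \<Rightarrow> real. continuous_on X f \<Longrightarrow> integral\<^sup>L M f = integral\<^sup>L N f"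
  shows "M = N"
proof (rule measure_eqI_generator_eq[where E="(\<inter>) X ` Collect closed" and \<Omega>=X and A="\<lambda>_. X"])
  show "Int_stable ((\<inter>) X ` Collect closed)"
  proof (rule Int_stableI_image)
    fix F H :: "'a set" assume "F \<in> Collect closed" "H \<in> Collect closed"
    then show "\<exists>K\<in>Collect closed. X \<inter> F \<inter> (X \<inter> H) = X \<inter> K"
      by (intro bexI[of _ "F \<inter> H"]) auto
  qed
  have "sets (restrict_space borel X) = sigma_sets X ((\<inter>) X ` Collect closed)"
    unfolding sets_restrict_space borel_eq_closed
    using compact_imp_closed[OF X] by (simp add: sigma_sets_Int)
  then show "sets M = sigma_sets X ((\<inter>) X ` Collect closed)" "sets N = sigma_sets X ((\<inter>) X ` Collect closed)"
    using M N by simp_all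
  have fin: "finite_measure M" "finite_measure N"
    using M N by (simp_all add: prob_space.finite_measure)
  show "emeasure M X \<noteq> \<infinity>"
    using finite_measure.emeasure_finite[OF fin(1)] by simp
  have "X \<in> (\<inter>) X ` Collect closed"
    by (rule image_eqI[of _ _ UNIV]) auto
  then show "range (\<lambda>_. X) \<subseteq> (\<inter>) X ` Collect closed"
    by blast
  fix A assume "A \<in> (\<inter>) X ` Collect closed"
  then obtain F where F: "closed F" "A = X \<inter> F" by auto
  show "emeasure M A = emeasure N A"
  \<comment> \<open>\<open>infdist\<close> to the empty set is 0 by convention, so the cut-offs
    below would be constantly 1 there.\<close>
  proof (cases "F = {}")
    case False
    define g where "g k x = max 0 (1 - real k * infdist x F)" for k :: nat and x
    have g: "continuous_on X (g k)" "0 \<le> g k x" "g k x \<le> 1" for k x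
      unfolding g_def by (auto intro!: continuous_intros simp: infdist_nonneg)
    have lim: "(\<lambda>k. g k x) \<longlonglongrightarrow> indicator A x" if "x \<in> X" for x
    proof (cases "x \<in> F")
      case True
      then show ?thesis using that F by (simp add: g_def)
    next
      case nF: False
      show ?thesis
        using eventually_one_le_mult_infdist[OF F(1) False nF] F nF
        by (intro tendsto_eventually, elim eventually_mono) (simp add: g_def)
    qed
    have conv: "(\<lambda>k. integral\<^sup>L Q (g k)) \<longlonglongrightarrow> measure Q A"
      if Q: "sets Q = sets (restrict_space borel X)" "prob_space Q" for Q
    proof -
      interpret Q: prob_space Q by fact
      have space: "space Q = X"
        using sets_eq_imp_space_eq[OF Q(1)] by (simp add: space_restrict_space)
      have A: "A \<in> sets Q"
        unfolding Q(1) F(2) sets_restrict_space by (rule imageI) (simp add: F(1))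
      have "(\<lambda>k. integral\<^sup>L Q (g k)) \<longlonglongrightarrow> integral\<^sup>L Q (indicator A :: 'a \<Rightarrow> real)"
      proof (rule integral_dominated_convergence[where w="\<lambda>_. 1"])
        show "g k \<in> borel_measurable Q" for k
          by (rule integrable_continuous_on_compact(1)[OF X Q(1) Q.finite_measure_axioms g(1)])
        show "AE x in Q. (\<lambda>k. g k x) \<longlonglongrightarrow> indicator A x"
          by (rule AE_I2) (simp add: lim space)
        show "AE x in Q. norm (g k x) \<le> 1" for k
          by (rule AE_I2) (simp add: g)
      qed (use A in auto)
      then show ?thesis
        using A by simp
    qed
    have "measure M A = measure N A"
      using conv[OF M] conv[OF N] unfolding eq[OF g(1)] by (rule LIMSEQ_unique)
    then show ?thesis
      using fin by (simp add: finite_measure.emeasure_eq_measure)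
  qed (simp add: F)
qed auto

lemma measurable_continuous_self_map:
  fixes X :: "'a::metric_space set"
  assumes T: "continuous_on X T" "T ` X \<subseteq> X" and M: "sets M = sets (restrict_space borel X)"
  shows "T \<in> measurable M M"
proof -
  have "T \<in> measurable (restrict_space borel X) (restrict_space borel X)"
    by (rule measurable_restrict_space2)
      (use T borel_measurable_continuous_on_restrict[OF T(1)] in \<open>auto simp: space_restrict_space\<close>)
  then show ?thesis
    by (simp add: measurable_cong_sets[OF M M])
qed

section \<open>The Riesz representation theorem on a compact metric space\<close>

text \<open>\<open>L\<close> is a total function, but its values are constrained only on functions
  continuous on \<open>X\<close>. That for these it depends only on the restriction to
  \<open>X\<close> is a consequence of positivity (\<open>cong\<close>).\<close>

locale positive_functional =
  fixes X :: "'a::metric_space set" and L :: "('a \<Rightarrow> real) \<Rightarrow> real"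
  assumes compact: "compact X"
    and add: "continuous_on X f \<Longrightarrow> continuous_on X g \<Longrightarrow> L (\<lambda>x. f x + g x) = L f + L g"
    and scale: "continuous_on X f \<Longrightarrow> L (\<lambda>x. c * f x) = c * L f"
    and nonneg: "continuous_on X f \<Longrightarrow> (\<And>x. x \<in> X \<Longrightarrow> 0 \<le> f x) \<Longrightarrow> 0 \<le> L f"
    and one: "L (\<lambda>_. 1) = 1"
begin

lemma diff: "continuous_on X f \<Longrightarrow> continuous_on X g \<Longrightarrow> L (\<lambda>x. f x - g x) = L f - L g"
  using add[of f "\<lambda>x. (-1) * g x"] scale[of g "-1"] by (simp add: continuous_intros)

lemma mono:
  assumes "continuous_on X f" "continuous_on X g" "\<And>x. x \<in> X \<Longrightarrow> f x \<le> g x"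
  shows "L f \<le> L g"
  using nonneg[of "\<lambda>x. g x - f x"] diff[of g f] assms by (auto intro: continuous_intros)

lemma cong:
  assumes "continuous_on X f" "\<And>x. x \<in> X \<Longrightarrow> f x = g x"
  shows "L f = L g"
proof -
  have "continuous_on X g"
    using assms by (metis continuous_on_cong)
  then show ?thesis
    using assms by (intro antisym mono) auto
qed

lemma zero: "L (\<lambda>_. 0) = 0"
  using scale[of "\<lambda>_. 1" 0] by simp

lemma sum: "(\<And>i. i \<in> I \<Longrightarrow> continuous_on X (f i)) \<Longrightarrow> L (\<lambda>x. \<Sum>i\<in>I. f i x) = (\<Sum>i\<in>I. L (f i))"
proof (induction I rule: infinite_finite_induct)
  case (insert i I)
  then show ?case
    by (simp add: add continuous_intros)
qed (auto simp: zero)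

text \<open>Daniell-style outer measure: sets are covered by countable sums of continuous functions
  instead of by open sets, which makes countable subadditivity immediate.\<close>

definition covers :: "'a set \<Rightarrow> (nat \<Rightarrow> 'a \<Rightarrow> real) \<Rightarrow> bool" where
  "covers A f \<longleftrightarrow> (\<forall>i. continuous_on X (f i) \<and> (\<forall>x\<in>X. 0 \<le> f i x)) \<and>
     (\<forall>x\<in>A. 1 \<le> (\<Sum>i. ennreal (f i x)))"

definition outer :: "'a set \<Rightarrow> ennreal" where
  "outer A = (INF f\<in>{f. covers A f}. \<Sum>i. ennreal (L (f i)))"

lemma outer_le: "covers A f \<Longrightarrow> outer A \<le> (\<Sum>i. ennreal (L (f i)))"
  unfolding outer_def by (rule INF_lower) simp

text \<open>The pairing bijection of \<open>nat\<close> flattens a doubly indexed cover. Such covers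
  arise twice: from a sequence of covers in countable subadditivity, and from cutting each function
  into increments when a set is split along a closed set.\<close>

lemma outer_le_double:
  assumes cont: "\<And>i j. continuous_on X (h i j)" and nn: "\<And>i j x. x \<in> X \<Longrightarrow> 0 \<le> h i j x"
    and cov: "\<And>x. x \<in> A \<Longrightarrow> 1 \<le> (\<Sum>i. \<Sum>j. ennreal (h i j x))"
  shows "outer A \<le> (\<Sum>i. \<Sum>j. ennreal (L (h i j)))"
proof -
  define f where "f k = case_prod h (prod_decode k)" for k
  have f: "(\<Sum>k. ennreal (f k x)) = (\<Sum>i. \<Sum>j. ennreal (h i j x))" for x
    unfolding f_def
    using suminf_ennreal_2dimen[where f="\<lambda>(i,j). ennreal (h i j x)" and g="\<lambda>i. \<Sum>j. ennreal (h i j x)"]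
    by (simp add: split_def)
  have Lf: "(\<Sum>k. ennreal (L (f k))) = (\<Sum>i. \<Sum>j. ennreal (L (h i j)))"
    unfolding f_def
    using suminf_ennreal_2dimen[where f="\<lambda>(i,j). ennreal (L (h i j))" and g="\<lambda>i. \<Sum>j. ennreal (L (h i j))"]
    by (simp add: split_def)
  have "covers A f"
    unfolding covers_def f using cov by (auto simp: f_def split_def cont nn)
  from outer_le[OF this] show ?thesis
    by (simp add: Lf)
qed

lemma outer_mono: "A \<subseteq> B \<Longrightarrow> outer A \<le> outer B"
  unfolding outer_def by (rule INF_superset_mono) (auto simp: covers_def subset_iff)

lemma outer_empty: "outer {} = 0"
  using outer_le[of "{}" "\<lambda>_ _. 0"] by (simp add: covers_def zero)

lemma outer_measure_space_outer: "outer_measure_space (Pow X) outer"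
  unfolding outer_measure_space_def
proof (intro conjI)
  show "positive (Pow X) outer"
    by (simp add: positive_def outer_empty)
  show "increasing (Pow X) outer"
    by (auto simp: increasing_def intro: outer_mono)
  show "countably_subadditive (Pow X) outer"
    unfolding countably_subadditive_def
  proof (intro allI impI)
    fix A :: "nat \<Rightarrow> 'a set"
    show "outer (\<Union>i. A i) \<le> (\<Sum>n. outer (A n))"
    proof (rule ennreal_le_epsilon)
      fix e :: real assume e: "0 < e" "(\<Sum>n. outer (A n)) < top"
      have "\<exists>f. covers (A n) f \<and> (\<Sum>i. ennreal (L (f i))) \<le> outer (A n) + e * (1/2)^Suc n" for n
      proof -
        have "outer (A n) < top"
          using e(2) by (auto simp: less_top dest!: ennreal_suminf_lessD)
        then show ?thesis
          using INF_approx_ennreal[of "e * (1/2)^Suc n" "outer (A n)" "\<lambda>f. \<Sum>i. ennreal (L (f i))" "{f. covers (A n) f}"] e(1)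
          by (auto simp: outer_def less_imp_le less_top[symmetric])
      qed
      then obtain F where F: "\<And>n. covers (A n) (F n)"
        "\<And>n. (\<Sum>i. ennreal (L (F n i))) \<le> outer (A n) + e * (1/2)^Suc n"
        by metis
      have "outer (\<Union>i. A i) \<le> (\<Sum>n. \<Sum>i. ennreal (L (F n i)))"
      proof (rule outer_le_double)
        fix x assume "x \<in> (\<Union>i. A i)"
        then obtain n where "x \<in> A n" by auto
        then have "1 \<le> (\<Sum>j. ennreal (F n j x))"
          using F(1)[of n] by (auto simp: covers_def)
        also have "\<dots> \<le> (\<Sum>i. \<Sum>j. ennreal (F i j x))"
          using sum_le_suminf[of "\<lambda>i. \<Sum>j. ennreal (F i j x)" "{n}"] by simp
        finally show "1 \<le> (\<Sum>i. \<Sum>j. ennreal (F i j x))" .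
      qed (use F(1) in \<open>auto simp: covers_def\<close>)
      also have "\<dots> \<le> (\<Sum>n. outer (A n) + e * (1/2) ^ Suc n)"
        by (intro suminf_le F) auto
      also have "\<dots> = (\<Sum>n. outer (A n)) + (\<Sum>n. ennreal e * ennreal ((1/2) ^ Suc n))"
        using \<open>0 < e\<close> by (subst suminf_add[symmetric])
          (auto simp del: ennreal_suminf_cmult simp add: ennreal_mult[symmetric])
      also have "\<dots> = (\<Sum>n. outer (A n)) + e"
        unfolding ennreal_suminf_cmult
        by (subst suminf_ennreal_eq[OF zero_le_power power_half_series]) auto
      finally show "outer (\<Union>i. A i) \<le> (\<Sum>n. outer (A n)) + e" .
    qed
  qed
qed

text \<open>With \<open>g k\<close> increasing to the indicator of the complement of \<open>F\<close>, a cover \<open>f\<close> of \<open>E\<close> splits into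
  the cover \<open>f i * (1 - g K)\<close> of \<open>E \<inter> F\<close> and the cover \<open>f i * (g (k + 1) - g k)\<close> of \<open>E - F\<close>; the cost
  of the latter telescopes.\<close>

lemma outer_closed_split:
  assumes F: "closed F" "F \<noteq> {}" and E: "E \<subseteq> X"
  shows "outer (E \<inter> F) + outer (E - F) \<le> outer E"
  unfolding outer_def[of E]
proof (rule INF_greatest)
  fix f assume "f \<in> {f. covers E f}"
  then have f: "continuous_on X (f i)" "x \<in> X \<Longrightarrow> 0 \<le> f i x" "x \<in> E \<Longrightarrow> 1 \<le> (\<Sum>i. ennreal (f i x))"
    for i x by (auto simp: covers_def)
  define g where "g k x = min 1 (real k * infdist x F)" for k x
  have g: "continuous_on X (g k)" "0 \<le> g k x" "g k x \<le> 1" "g k x \<le> g (Suc k) x" "g 0 x = 0" for k x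
  proof -
    have "real k * infdist x F \<le> real (Suc k) * infdist x F"
      by (intro mult_right_mono) (auto simp: infdist_nonneg)
    then show "g k x \<le> g (Suc k) x"
      unfolding g_def by linarith
  qed (auto simp: g_def intro!: continuous_intros simp: infdist_nonneg)
  have g_lim: "(\<lambda>k. g k x) \<longlonglongrightarrow> 1" if "x \<notin> F" for x
    using eventually_one_le_mult_infdist[OF F that]
    by (intro tendsto_eventually, elim eventually_mono) (simp add: g_def)
  define a where "a i K = ennreal (L (\<lambda>x. f i x * g K x))" for i K
  have inc_a: "incseq (a i)" for i
    unfolding a_def incseq_Suc_iff
    by (intro allI ennreal_leI mono continuous_intros f g mult_left_mono)
  have "outer (E - F) \<le> (\<Sum>i. \<Sum>k. ennreal (L (\<lambda>x. f i x * (g (Suc k) x - g k x))))"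
  proof (rule outer_le_double)
    fix x assume x: "x \<in> E - F"
    have "(\<Sum>k. ennreal (f i x * (g (Suc k) x - g k x))) = ennreal (f i x)" for i
    proof (rule suminf_ennreal_eq)
      have "(\<lambda>k. g (Suc k) x - g k x) sums (1 - g 0 x)"
        by (rule telescope_sums[OF g_lim]) (use x in auto)
      from sums_mult[OF this, of "f i x"]
      show "(\<lambda>k. f i x * (g (Suc k) x - g k x)) sums f i x"
        by (simp add: g)
      show "0 \<le> f i x * (g (Suc k) x - g k x)" for k
        using f(2)[of x i] g(4)[of k x] x E by auto
    qed
    then show "1 \<le> (\<Sum>i. \<Sum>k. ennreal (f i x * (g (Suc k) x - g k x)))"
      using f(3) x by simp
  qed (use f g E in \<open>auto intro!: continuous_intros\<close>)
  also have "\<dots> = (\<Sum>i. SUP K. a i K)"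
  proof -
    have "(\<Sum>k. ennreal (L (\<lambda>x. f i x * (g (Suc k) x - g k x)))) = (SUP K. a i K)" for i
    proof -
      have "(\<Sum>k<K. ennreal (L (\<lambda>x. f i x * (g (Suc k) x - g k x)))) = a i K" for K
      proof -
        have "L (\<lambda>x. f i x * (g (Suc k) x - g k x)) = L (\<lambda>x. f i x * g (Suc k) x) - L (\<lambda>x. f i x * g k x)" for k
          by (subst diff[symmetric]) (auto intro!: continuous_intros f g simp: right_diff_distrib)
        moreover have "0 \<le> L (\<lambda>x. f i x * (g (Suc k) x - g k x))" for k
          by (intro nonneg continuous_intros f g) (use f g in auto)
        ultimately show ?thesis
          using sum_lessThan_telescope[of "\<lambda>k. L (\<lambda>x. f i x * g k x)" K]
          by (subst sum_ennreal) (auto simp: a_def g zero)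
      qed
      then show ?thesis
        by (simp add: suminf_eq_SUP)
    qed
    then show ?thesis by simp
  qed
  also have "\<dots> = (SUP K. \<Sum>i. a i K)"
    by (rule ennreal_suminf_SUP_eq[OF inc_a])
  finally have 1: "outer (E - F) \<le> (SUP K. \<Sum>i. a i K)" .
  have 2: "outer (E \<inter> F) + (\<Sum>i. a i K) \<le> (\<Sum>i. ennreal (L (f i)))" for K
  proof -
    have "g K x = 0" if "x \<in> F" for x
      using that by (simp add: g_def)
    then have "outer (E \<inter> F) \<le> (\<Sum>i. ennreal (L (\<lambda>x. f i x * (1 - g K x))))"
      by (intro outer_le) (use f g in \<open>auto simp: covers_def intro!: continuous_intros mult_nonneg_nonneg\<close>)
    then have "outer (E \<inter> F) + (\<Sum>i. a i K) \<le> (\<Sum>i. ennreal (L (\<lambda>x. f i x * (1 - g K x)))) + (\<Sum>i. a i K)"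
      by (rule add_right_mono)
    also have "\<dots> = (\<Sum>i. ennreal (L (\<lambda>x. f i x * (1 - g K x))) + a i K)"
      by (rule suminf_add) auto
    also have "\<dots> = (\<Sum>i. ennreal (L (f i)))"
    proof (rule suminf_cong)
      fix i
      have "L (\<lambda>x. f i x * (1 - g K x)) + L (\<lambda>x. f i x * g K x) = L (f i)"
        by (subst add[symmetric]) (auto intro!: continuous_intros f g simp: algebra_simps)
      moreover have "0 \<le> L (\<lambda>x. f i x * (1 - g K x))" "0 \<le> L (\<lambda>x. f i x * g K x)"
        by (intro nonneg continuous_intros f g; use f g in auto)+
      ultimately show "ennreal (L (\<lambda>x. f i x * (1 - g K x))) + a i K = ennreal (L (f i))"
        by (simp add: a_def flip: ennreal_plus)
    qed
    finally show ?thesis .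
  qed
  have "outer (E \<inter> F) + outer (E - F) \<le> outer (E \<inter> F) + (SUP K. \<Sum>i. a i K)"
    by (intro add_left_mono 1)
  also have "\<dots> = (SUP K. outer (E \<inter> F) + (\<Sum>i. a i K))"
    by (rule ennreal_SUP_add_right) simp
  also have "\<dots> \<le> (\<Sum>i. ennreal (L (f i)))"
    by (intro SUP_least 2)
  finally show "outer (E \<inter> F) + outer (E - F) \<le> (\<Sum>i. ennreal (L (f i)))" .
qed

text \<open>\<open>outer_closed_split\<close> and subadditivity give Caratheodory's criterion for
  relatively closed sets; as the Caratheodory-measurable sets form a sigma-algebra, all Borel
  subsets of \<open>X\<close> follow.\<close>

lemma sets_subset_lambda_system:
  "sets (restrict_space borel X) \<subseteq> lambda_system X (Pow X) outer"
proof -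
  interpret P: sigma_algebra X "Pow X"
    by (rule sigma_algebra_Pow)
  have "measure_space X (lambda_system X (Pow X) outer) outer"
    by (rule P.caratheodory_lemma[OF outer_measure_space_outer])
  then interpret S: sigma_algebra X "lambda_system X (Pow X) outer"
    by (simp add: measure_space_def)
  have sub: "subadditive (Pow X) outer"
    using outer_measure_space_outer P.countably_subadditive_subadditive
    by (auto simp: outer_measure_space_def)
  have "X \<inter> F \<in> lambda_system X (Pow X) outer" if "closed F" for F
  proof (cases "F = {}")
    case True
    then show ?thesis by simp
  next
    case False
    show ?thesis
      unfolding P.lambda_system_eq
    proof (safe)
      fix E assume E: "E \<subseteq> X"
      then have eq: "E \<inter> (X \<inter> F) = E \<inter> F" "E - X \<inter> F = E - F"
        by auto
      have "outer E \<le> outer (E \<inter> F) + outer (E - F)"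
        using subadditiveD[OF sub, of "E \<inter> F" "E - F"] E by (auto simp: Int_Diff_Un)
      then show "outer (E \<inter> (X \<inter> F)) + outer (E - X \<inter> F) = outer E"
        unfolding eq using outer_closed_split[OF that False E] by (intro antisym)
    qed
  qed
  moreover have "sets (restrict_space borel X) = sigma_sets X ((\<inter>) X ` Collect closed)"
    unfolding sets_restrict_space borel_eq_closed
    using compact_imp_closed[OF compact] by (simp add: sigma_sets_Int)
  ultimately show ?thesis
    by (auto intro!: S.sigma_sets_subset)
qed

section \<open>The measure representing the functional\<close>

definition riesz_measure :: "'a measure" where
  "riesz_measure = measure_of X (sets (restrict_space borel X)) outer"

lemma sets_riesz_measure: "sets riesz_measure = sets (restrict_space borel X)"
  and space_riesz_measure: "space riesz_measure = X"
  unfolding riesz_measure_def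
  using sets.sets_measure_of_eq[of "restrict_space borel X"] sets.space_closed[of "restrict_space borel X"]
  by (auto simp: space_restrict_space space_measure_of_conv)

lemma emeasure_riesz_measure:
  assumes "A \<in> sets (restrict_space borel X)"
  shows "emeasure riesz_measure A = outer A"
  unfolding riesz_measure_def
proof (rule emeasure_measure_of_sigma)
  interpret P: sigma_algebra X "Pow X"
    by (rule sigma_algebra_Pow)
  have "measure_space X (lambda_system X (Pow X) outer) outer"
    by (rule P.caratheodory_lemma[OF outer_measure_space_outer])
  then have "countably_additive (lambda_system X (Pow X) outer) outer"
    by (simp add: measure_space_def)
  then show "countably_additive (sets (restrict_space borel X)) outer"
    using sets_subset_lambda_system unfolding countably_additive_def by blast
  show "sigma_algebra X (sets (restrict_space borel X))"
    using sets.sigma_algebra_axioms[of "restrict_space borel X"] by (simp add: space_restrict_space)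
qed (use assms in \<open>auto simp: positive_def outer_empty\<close>)

text \<open>The constant 1 is a cover of cost 1. Conversely, a Dini argument on the compact
  \<open>X\<close> shows that finitely many functions of any cover already sum to at least
  \<open>1 - e\<close> everywhere, and monotonicity of \<open>L\<close> bounds their cost from
  below.\<close>

lemma outer_space: "outer X = 1"
proof (rule antisym)
  have "outer X \<le> (\<Sum>i. ennreal (L (if i = (0::nat) then (\<lambda>_. 1) else (\<lambda>_. 0))))"
    by (rule outer_le, unfold covers_def, subst suminf_finite[of "{0}"]) auto
  also have "\<dots> = 1"
    by (subst suminf_finite[of "{0}"]) (auto simp: zero one)
  finally show "outer X \<le> 1" .
  show "1 \<le> outer X"
    unfolding outer_def
  proof (rule INF_greatest, rule ennreal_le_epsilon)
    fix f and e :: real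
    assume e: "0 < e" and "f \<in> {f. covers X f}"
    then have f: "continuous_on X (f i)" "x \<in> X \<Longrightarrow> 0 \<le> f i x" "x \<in> X \<Longrightarrow> 1 \<le> (\<Sum>i. ennreal (f i x))"
      for i x by (auto simp: covers_def)
    have "\<exists>n. \<forall>x\<in>X. 1 - e \<le> (\<Sum>i<n. f i x)"
    proof (rule ccontr)
      assume "\<nexists>n. \<forall>x\<in>X. 1 - e \<le> (\<Sum>i<n. f i x)"
      then obtain y where y: "\<And>n. y n \<in> X" "\<And>n. (\<Sum>i<n. f i (y n)) < 1 - e"
        by (metis not_le)
      obtain l \<sigma> where l: "l \<in> X" "strict_mono \<sigma>" "(y \<circ> \<sigma>) \<longlonglongrightarrow> l"
        using compact y(1) by (metis seq_compactE compact_imp_seq_compact)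
      \<comment> \<open>Partial sums increase, so the failure at index \<open>\<sigma> k\<close>
        passes down to every fixed \<open>N \<le> \<sigma> k\<close> and then, by continuity, to the
        limit point \<open>l\<close>.\<close>
      have "(\<Sum>i<N. f i l) \<le> 1 - e" for N
      proof (rule tendsto_upperbound)
        have "continuous_on X (\<lambda>x. \<Sum>i<N. f i x)"
          by (intro continuous_intros f)
        then show "(\<lambda>k. \<Sum>i<N. f i ((y \<circ> \<sigma>) k)) \<longlonglongrightarrow> (\<Sum>i<N. f i l)"
          by (rule continuous_on_tendsto_compose[OF _ l(3,1)]) (use y in auto)
        show "\<forall>\<^sub>F k in sequentially. (\<Sum>i<N. f i ((y \<circ> \<sigma>) k)) \<le> 1 - e"
        proof (rule eventually_sequentiallyI)
          fix k assume "N \<le> k"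
          then have "N \<le> \<sigma> k"
            using seq_suble[OF l(2), of k] by simp
          then have "(\<Sum>i<N. f i (y (\<sigma> k))) \<le> (\<Sum>i<\<sigma> k. f i (y (\<sigma> k)))"
            by (intro sum_mono2) (auto intro: f y)
          then show "(\<Sum>i<N. f i ((y \<circ> \<sigma>) k)) \<le> 1 - e"
            using y(2)[of "\<sigma> k"] by simp
        qed
      qed simp
      then have "(\<Sum>i. ennreal (f i l)) \<le> ennreal (1 - e)"
        unfolding suminf_eq_SUP
        by (intro SUP_least) (auto simp: sum_ennreal f l intro!: ennreal_leI)
      also have "\<dots> < 1"
        using e by (simp add: ennreal_less_one_iff)
      finally show False
        using f(3)[OF l(1)] by simp
    qed
    then obtain n where n: "\<And>x. x \<in> X \<Longrightarrow> 1 - e \<le> (\<Sum>i<n. f i x)"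
      by auto
    have "L (\<lambda>_. (1 - e) * 1) \<le> L (\<lambda>x. \<Sum>i<n. f i x)"
      by (intro mono continuous_intros f) (use n in auto)
    then have "1 \<le> (\<Sum>i<n. L (f i)) + e"
      by (subst (asm) scale, simp, subst (asm) sum) (auto simp: one f)
    moreover have Lf: "0 \<le> L (f i)" for i
      by (intro nonneg f) auto
    ultimately have "1 \<le> ennreal (\<Sum>i<n. L (f i)) + ennreal e"
      using e by (subst ennreal_plus[symmetric]) (auto intro!: sum_nonneg simp: ennreal_ge_1)
    also have "ennreal (\<Sum>i<n. L (f i)) \<le> (\<Sum>i. ennreal (L (f i)))"
      unfolding sum_ennreal[OF Lf, symmetric] by (rule sum_le_suminf) auto
    finally show "1 \<le> (\<Sum>i. ennreal (L (f i))) + ennreal e"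
      by simp
  qed
qed

sublocale riesz: prob_space riesz_measure
proof
  have "X \<in> sets (restrict_space borel X)"
    using sets.top[of "restrict_space borel X"] by (simp add: space_restrict_space)
  then show "emeasure riesz_measure (space riesz_measure) = 1"
    by (simp add: space_riesz_measure emeasure_riesz_measure outer_space)
qed

lemmas measurable_riesz = integrable_continuous_on_compact(1)[OF compact sets_riesz_measure riesz.finite_measure_axioms]
  and integrable_riesz = integrable_continuous_on_compact(2)[OF compact sets_riesz_measure riesz.finite_measure_axioms]

text \<open>A layer-cake estimate: \<open>f\<close> is cut into horizontal slices \<open>s k\<close>
  of height \<open>d\<close>. On \<open>A k\<close> the slice \<open>s k\<close> is full, so
  \<open>s k / d\<close> covers \<open>A k\<close> and its cost bounds the measure; the slices add
  up to \<open>f\<close>.\<close>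

lemma integral_riesz_le:
  assumes f: "continuous_on X f" "\<And>x. x \<in> X \<Longrightarrow> 0 \<le> f x"
  shows "integral\<^sup>L riesz_measure f \<le> L f"
proof (rule field_le_epsilon)
  fix d :: real assume d: "0 < d"
  obtain B where B: "\<And>x. x \<in> X \<Longrightarrow> norm (f x) \<le> B"
    using compact_imp_bounded[OF compact_continuous_image[OF f(1) compact]]
    by (auto simp: bounded_iff)
  obtain N where "B / d < real N"
    using reals_Archimedean2 by blast
  then have N: "f x \<le> real N * d" if "x \<in> X" for x
    using B[OF that] d by (simp add: field_simps)
  define s where "s k x = min (max (f x - real k * d) 0) d" for k x
  have s: "continuous_on X (s k)" "0 \<le> s k x" "s k x \<le> d" for k x
    unfolding s_def using d by (auto intro!: continuous_intros f)
  have s_sum: "(\<Sum>k<n. s k x) = min (f x) (real n * d)" if "x \<in> X" for n x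
    using f(2)[OF that] d
    by (induction n) (auto simp: s_def min_def max_def algebra_simps)
  define A where "A k = {x\<in>X. (real k + 1) * d \<le> f x}" for k
  have A_sets: "A k \<in> sets riesz_measure" for k
    using measurable_sets[OF measurable_riesz[OF f(1)], of "{(real k + 1) * d ..}"]
    by (simp add: A_def space_riesz_measure vimage_def Int_def conj_commute)
  have A_le: "d * measure riesz_measure (A k) \<le> L (s k)" for k
  proof -
    have "covers (A k) (\<lambda>i. if i = 0 then (\<lambda>x. (1 / d) * s k x) else (\<lambda>_. 0))"
      unfolding covers_def
    proof (intro conjI ballI allI)
      fix x assume "x \<in> A k"
      then have "s k x = d"
        using d by (auto simp: A_def s_def algebra_simps)
      then show "1 \<le> (\<Sum>i. ennreal ((if i = 0 then (\<lambda>x. (1 / d) * s k x) else (\<lambda>_. 0)) x))"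
        using d by (subst suminf_finite[of "{0}"]) auto
    qed (use s d in \<open>auto intro!: continuous_intros\<close>)
    from outer_le[OF this] have "outer (A k) \<le> ennreal (L (\<lambda>x. (1 / d) * s k x))"
      by (subst (asm) suminf_finite[of "{0}"]) (auto simp: zero)
    moreover have "L (\<lambda>x. (1 / d) * s k x) = (1 / d) * L (s k)"
      by (rule scale) (rule s)
    ultimately have "ennreal (measure riesz_measure (A k)) \<le> ennreal ((1 / d) * L (s k))"
      using A_sets[of k] by (simp only: riesz.emeasure_eq_measure[symmetric] emeasure_riesz_measure sets_riesz_measure)
    moreover have "0 \<le> L (s k)"
      by (intro nonneg s)
    ultimately show ?thesis
      using d by (simp add: field_simps)
  qed
  have int: "integrable riesz_measure (\<lambda>x. d * indicator (A k) x)" for k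
    using A_sets by (intro integrable_mult_right integrable_real_indicator) (auto simp: less_top[symmetric])
  have "integral\<^sup>L riesz_measure f \<le> integral\<^sup>L riesz_measure (\<lambda>x. d + (\<Sum>k<N. d * indicator (A k) x))"
  proof (rule integral_mono)
    show "integrable riesz_measure (\<lambda>x. d + (\<Sum>k<N. d * indicator (A k) x))"
      by (intro Bochner_Integration.integrable_add Bochner_Integration.integrable_sum int riesz.integrable_const)
    fix x assume "x \<in> space riesz_measure"
    then have x: "x \<in> X" by (simp add: space_riesz_measure)
    \<comment> \<open>A slice is nonzero only where the one beneath it is full. The index shift
      leaves slice 0 without a partner, which is the error \<open>d\<close>.\<close>
    have "s (Suc k) x \<le> d * indicator (A k) x" for k
      using d x s(3)[of "Suc k" x] by (auto simp: s_def A_def indicator_def algebra_simps)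
    then have "(\<Sum>k<N. s (Suc k) x) \<le> (\<Sum>k<N. d * indicator (A k) x)"
      by (intro sum_mono)
    moreover have "f x = (\<Sum>k<Suc N. s k x)"
      using s_sum[OF x, of "Suc N"] N[OF x] d by (simp add: algebra_simps)
    ultimately show "f x \<le> d + (\<Sum>k<N. d * indicator (A k) x)"
      using s(3)[of 0 x] sum.lessThan_Suc_shift[of "\<lambda>k. s k x" N] by simp
  qed (rule integrable_riesz[OF f(1)])
  also have "\<dots> = d + (\<Sum>k<N. d * measure riesz_measure (A k))"
  proof -
    have "integral\<^sup>L riesz_measure (\<lambda>x. d * indicator (A k) x) = d * measure riesz_measure (A k)" for k
      using sets.Int_space_eq2[OF A_sets[of k]] by simp
    then show ?thesis
      by (subst Bochner_Integration.integral_add)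
        (simp_all only: Bochner_Integration.integral_sum[OF int] Bochner_Integration.integrable_sum[OF int]
          riesz.integrable_const, simp add: riesz.prob_space)
  qed
  also have "\<dots> \<le> d + (\<Sum>k<N. L (s k))"
    by (intro add_left_mono sum_mono A_le)
  also have "(\<Sum>k<N. L (s k)) = L (\<lambda>x. \<Sum>k<N. s k x)"
    by (rule sum[symmetric]) (rule s)
  also have "\<dots> = L f"
    by (rule cong, intro continuous_intros s) (use s_sum N in \<open>auto simp: min_absorb1\<close>)
  finally show "integral\<^sup>L riesz_measure f \<le> L f + d"
    by simp
qed

text \<open>The one-sided bound for nonnegative functions applies to both \<open>f + B\<close> and
  \<open>B - f\<close>, where \<open>B\<close> bounds \<open>f\<close> in absolute value; constants
  are integrated exactly.\<close>

theorem integral_riesz: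
  assumes f: "continuous_on X f"
  shows "integral\<^sup>L riesz_measure f = L f"
proof -
  obtain B where B: "\<And>x. x \<in> X \<Longrightarrow> norm (f x) \<le> B"
    using compact_imp_bounded[OF compact_continuous_image[OF f compact]]
    by (auto simp: bounded_iff)
  have c: "L (\<lambda>_. B) = B"
    using scale[of "\<lambda>_. 1" B] by (simp add: one)
  have "integral\<^sup>L riesz_measure (\<lambda>x. f x + B) \<le> L (\<lambda>x. f x + B)"
    by (rule integral_riesz_le) (use B in \<open>force intro!: continuous_intros f\<close>)+
  moreover have "integral\<^sup>L riesz_measure (\<lambda>x. B - f x) \<le> L (\<lambda>x. B - f x)"
    by (rule integral_riesz_le) (use B in \<open>force intro!: continuous_intros f\<close>)+
  ultimately show ?thesis
    using integrable_riesz[OF f] f by (simp add: add diff c riesz.prob_space)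
qed

end

section \<open>Weak-star limits of empirical measures\<close>

abbreviation birkhoff_mean :: "('a \<Rightarrow> 'a) \<Rightarrow> 'a \<Rightarrow> ('a \<Rightarrow> real) \<Rightarrow> nat \<Rightarrow> real" where
  "birkhoff_mean T x f n \<equiv> (\<Sum>j<n. f ((T ^^ j) x)) / real n"

lemma funpow_mem: "T ` X \<subseteq> X \<Longrightarrow> x \<in> X \<Longrightarrow> (T ^^ n) x \<in> X"
  by (induction n) auto

text \<open>The difference telescopes to a bounded quantity over \<open>n\<close>. This yields
  invariance of limit measures, and also reconciles averages over the times \<open>1..n\<close> with
  those over \<open>0..n-1\<close>.\<close>

lemma birkhoff_mean_shift_tendsto:
  fixes f :: "'a::metric_space \<Rightarrow> real"
  assumes "compact X" "T ` X \<subseteq> X" "x \<in> X" "continuous_on X f"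
  shows "(\<lambda>n. birkhoff_mean T x (\<lambda>y. f (T y)) n - birkhoff_mean T x f n) \<longlonglongrightarrow> 0"
proof -
  obtain B where B: "\<And>x. x \<in> X \<Longrightarrow> norm (f x) \<le> B"
    using compact_imp_bounded[OF compact_continuous_image[OF assms(4,1)]]
    by (auto simp: bounded_iff)
  have "birkhoff_mean T x (\<lambda>y. f (T y)) n - birkhoff_mean T x f n = (f ((T ^^ n) x) - f x) / real n" for n
    using sum_lessThan_telescope[of "\<lambda>j. f ((T ^^ j) x)" n]
    by (simp only: sum_subtractf[symmetric] diff_divide_distrib[symmetric]) simp
  moreover have "\<bar>f ((T ^^ n) x) - f x\<bar> \<le> 2 * B" for n
    using B[OF funpow_mem[OF assms(2,3), of n]] B[OF assms(3)] by simp
  ultimately have "norm (birkhoff_mean T x (\<lambda>y. f (T y)) n - birkhoff_mean T x f n) \<le> (2 * B) / real n" for n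
    by (simp add: divide_right_mono)
  then show ?thesis
    by (intro Lim_null_comparison[OF _ lim_const_over_n[of "2 * B"]] always_eventually allI)
qed

text \<open>Tychonoff's theorem replaces a diagonal argument, so no separability of the space of continuous
  functions is needed; the price is a filter \<open>G\<close> instead of a subsequence.\<close>

lemma bounded_family_common_limit:
  fixes A :: "nat \<Rightarrow> 'b \<Rightarrow> real"
  assumes bdd: "\<And>n f. \<bar>A n f\<bar> \<le> B f"
  obtains G L where "G \<noteq> bot" "G \<le> sequentially" "\<And>f. ((\<lambda>n. A n f) \<longlongrightarrow> L f) G"
proof -
  define K where "K = PiE UNIV (\<lambda>f. {- B f..B f})"
  have "compactin (product_topology (\<lambda>_. euclidean) UNIV) K"
    unfolding K_def compactin_PiE by simp
  then have "compact K"
    by (simp add: euclidean_product_topology)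
  moreover have "A n \<in> K" for n
    using bdd by (auto simp: K_def abs_le_iff minus_le_iff)
  then have "eventually (\<lambda>h. h \<in> K) (filtermap A sequentially)"
    by (simp add: eventually_filtermap)
  moreover have "filtermap A sequentially \<noteq> bot"
    by (simp add: filtermap_bot_iff)
  ultimately obtain L where L: "inf (nhds L) (filtermap A sequentially) \<noteq> bot"
    unfolding compact_filter by blast
  \<comment> \<open>Pulling the neighbourhoods of the cluster point back along \<open>A\<close>
    turns clustering into convergence; clustering says precisely that the resulting filter is not
    trivial.\<close>
  define G where "G = inf sequentially (filtercomap A (nhds L))"
  show ?thesis
  proof
    show "G \<noteq> bot"
    proof
      assume "G = bot"
      then have "eventually (\<lambda>_. False) G" by simp
      then obtain P Q where PQ: "eventually P sequentially" "eventually Q (filtercomap A (nhds L))"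
        "\<And>n. P n \<Longrightarrow> Q n \<Longrightarrow> False"
        unfolding G_def eventually_inf by auto
      then obtain R where R: "eventually R (nhds L)" "\<And>n. R (A n) \<Longrightarrow> Q n"
        by (auto simp: eventually_filtercomap)
      have "eventually (\<lambda>y. \<not> R y) (filtermap A sequentially)"
        unfolding eventually_filtermap using PQ(1) by eventually_elim (use PQ(3) R(2) in blast)
      then have "eventually (\<lambda>_. False) (inf (nhds L) (filtermap A sequentially))"
        unfolding eventually_inf using R(1) by blast
      then show False
        using L by (simp add: eventually_False)
    qed
    show "G \<le> sequentially"
      by (simp add: G_def)
    have lim: "filterlim A (nhds L) G"
      unfolding G_def by (rule filterlim_mono[OF filterlim_filtercomap]) auto
    fix f
    show "((\<lambda>n. A n f) \<longlongrightarrow> L f) G"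
    proof (rule topological_tendstoI)
      fix S :: "real set" assume S: "open S" "L f \<in> S"
      have "open ((\<lambda>h :: 'b \<Rightarrow> real. h f) -` S)"
        by (rule open_vimage[OF S(1) continuous_on_product_coordinates])
      then have "eventually (\<lambda>h. h f \<in> S) (nhds L)"
        using S(2) by (auto simp: eventually_nhds)
      then show "eventually (\<lambda>n. A n f \<in> S) G"
        using lim unfolding filterlim_iff by blast
    qed
  qed
qed

theorem empirical_measures_cluster:
  fixes X :: "'a::metric_space set"
  assumes X: "compact X" and T: "continuous_on X T" "T ` X \<subseteq> X" and x: "x \<in> X"
  obtains G \<mu> where "G \<noteq> bot" "G \<le> sequentially" "\<mu> \<in> invariant_measures X T"
    "\<And>f. continuous_on X f \<Longrightarrow> (birkhoff_mean T x f \<longlongrightarrow> integral\<^sup>L \<mu> f) G"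
proof -
  \<comment> \<open>The value 0 at discontinuous \<open>f\<close> keeps the family bounded at every
    index \<open>f\<close>, as Tychonoff's theorem is applied to all real functions at once.\<close>
  define A where "A n f = (if continuous_on X f then birkhoff_mean T x f n else 0)" for n f
  have "\<exists>B. \<forall>n. \<bar>A n f\<bar> \<le> B" for f
  proof (cases "continuous_on X f")
    case True
    then obtain B where B: "\<And>x. x \<in> X \<Longrightarrow> norm (f x) \<le> B"
      using compact_imp_bounded[OF compact_continuous_image[OF _ X, of f]]
      by (auto simp: bounded_iff)
    have "\<bar>A n f\<bar> \<le> \<bar>B\<bar>" for n
    proof -
      have "\<bar>f ((T ^^ j) x)\<bar> \<le> \<bar>B\<bar>" for j
        using B[OF funpow_mem[OF T(2) x], of j] by simp
      then have "\<bar>\<Sum>j<n. f ((T ^^ j) x)\<bar> \<le> (\<Sum>j<n. \<bar>B\<bar>)"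
        by (intro order_trans[OF sum_abs sum_mono])
      then show ?thesis
        using True by (cases "n = 0") (auto simp: A_def field_simps)
    qed
    then show ?thesis by blast
  qed (auto simp: A_def)
  then obtain B where "\<And>n f. \<bar>A n f\<bar> \<le> B f" by metis
  then obtain G L where G: "G \<noteq> bot" "G \<le> sequentially" and L_lim: "\<And>f. ((\<lambda>n. A n f) \<longlongrightarrow> L f) G"
    using bounded_family_common_limit by metis
  then have lim: "(birkhoff_mean T x f \<longlongrightarrow> L f) G" if "continuous_on X f" for f
    using that L_lim[of f] by (simp add: A_def)
  interpret L: positive_functional X L
  proof
    show "compact X" by fact
    show "L (\<lambda>x. f x + g x) = L f + L g" if "continuous_on X f" "continuous_on X g" for f g
      by (rule tendsto_unique[OF G(1) lim[OF continuous_on_add[OF that]]])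
        (use tendsto_add[OF lim[OF that(1)] lim[OF that(2)]] in \<open>simp add: sum.distrib add_divide_distrib\<close>)
    show "L (\<lambda>x. c * f x) = c * L f" if "continuous_on X f" for c f
      by (rule tendsto_unique[OF G(1) lim[OF continuous_on_mult_left[OF that]]])
        (use tendsto_mult_left[OF lim[OF that], of c] in \<open>simp add: sum_distrib_left[symmetric]\<close>)
    show "0 \<le> L f" if "continuous_on X f" "\<And>x. x \<in> X \<Longrightarrow> 0 \<le> f x" for f
      by (rule tendsto_lowerbound[OF lim[OF that(1)] _ G(1)])
        (auto intro!: always_eventually divide_nonneg_nonneg sum_nonneg that(2) funpow_mem[OF T(2) x])
    \<comment> \<open>The mean over the empty orbit segment \<open>n = 0\<close> is 0, so the value
      1 is attained only eventually.\<close>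
    have "\<forall>\<^sub>F n in sequentially. birkhoff_mean T x (\<lambda>_. 1) n = 1"
      using eventually_gt_at_top[of 0] by eventually_elim auto
    then have "(birkhoff_mean T x (\<lambda>_. 1) \<longlongrightarrow> 1) G"
      using filter_leD[OF G(2)] by (intro tendsto_eventually) blast
    then show "L (\<lambda>_. 1) = 1"
      by (rule tendsto_unique[OF G(1) lim[OF continuous_on_const]])
  qed
  let ?\<mu> = "L.riesz_measure"
  have space: "space ?\<mu> = X" and sets: "sets ?\<mu> = sets (restrict_space borel X)"
    by (rule L.space_riesz_measure L.sets_riesz_measure)+
  have T_meas: "T \<in> measurable ?\<mu> ?\<mu>"
    by (rule measurable_continuous_self_map[OF T sets])
  \<comment> \<open>Measures are compared on continuous functions, where the shift estimate shows
    that \<open>L\<close> cannot distinguish \<open>f\<close> from its composition with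
    \<open>T\<close>.\<close>
  have inv: "distr ?\<mu> ?\<mu> T = ?\<mu>"
  proof (rule measure_eqI_continuous[OF X])
    show "prob_space (distr ?\<mu> ?\<mu> T)"
      by (rule L.riesz.prob_space_distr[OF T_meas])
    fix f :: "'a \<Rightarrow> real" assume f: "continuous_on X f"
    then have fT: "continuous_on X (\<lambda>y. f (T y))"
      using continuous_on_compose2[OF f T(1)] T(2) by blast
    have "L (\<lambda>y. f (T y)) - L f = 0"
      by (rule tendsto_unique[OF G(1) tendsto_diff[OF lim[OF fT] lim[OF f]]])
        (rule tendsto_mono[OF G(2) birkhoff_mean_shift_tendsto[OF X T(2) x f]])
    then show "integral\<^sup>L (distr ?\<mu> ?\<mu> T) f = integral\<^sup>L ?\<mu> f"
      by (simp add: integral_distr[OF T_meas L.measurable_riesz[OF f]] L.integral_riesz f fT)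
  qed (use sets L.riesz.prob_space_axioms in auto)
  have "?\<mu> \<in> invariant_measures X T"
    unfolding invariant_measures_def
  proof (intro CollectI conjI ballI)
    fix A assume "A \<in> sets ?\<mu>"
    from emeasure_distr[OF T_meas this]
    show "emeasure ?\<mu> (T -` A \<inter> X) = emeasure ?\<mu> A"
      unfolding inv space by (rule sym)
  qed (fact sets L.riesz.prob_space_axioms)+
  then show ?thesis
    by (rule that[OF G]) (simp_all add: lim L.integral_riesz)
qed

section \<open>Multiple ergodic averages along weak-star limits\<close>

text \<open>The algebra for the Stone-Weierstrass theorem. Scalars need no rule of their own: a
  constant is absorbed into the factor of index 0, which exists when
  \<open>1 \<le> r\<close>.\<close>

inductive_set product_sums :: "'a::metric_space set \<Rightarrow> nat \<Rightarrow> ((nat \<Rightarrow> 'a) \<Rightarrow> real) set"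
  for X :: "'a set" and r :: nat where
  prod: "(\<And>k. k < r \<Longrightarrow> continuous_on X (f k)) \<Longrightarrow> (\<lambda>z. \<Prod>k<r. f k (z k)) \<in> product_sums X r"
| add: "g \<in> product_sums X r \<Longrightarrow> h \<in> product_sums X r \<Longrightarrow> (\<lambda>z. g z + h z) \<in> product_sums X r"

lemma product_sums_mult:
  assumes "g \<in> product_sums X r" "h \<in> product_sums X r"
  shows "(\<lambda>z. g z * h z) \<in> product_sums X r"
  using assms
proof (induction g)
  case (prod f)
  from this(2,1) show ?case
  proof (induction h)
    case (prod f')
    have "(\<lambda>z. \<Prod>k<r. (\<lambda>y. f k y * f' k y) (z k)) \<in> product_sums X r"
      by (rule product_sums.prod) (intro continuous_intros prod)
    then show ?case
      by (simp add: prod.distrib)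
  next
    case (add g h)
    then show ?case
      using product_sums.add by (simp add: distrib_left)
  qed
next
  case (add g g')
  then show ?case
    using product_sums.add by (simp add: distrib_right)
qed

text \<open>Members of \<open>PiE\<close> take the value \<open>undefined\<close> outside the index
  set, so the set is a full product with the singleton \<open>{undefined}\<close> as factor at every
  other index, and Tychonoff's theorem applies.\<close>

lemma compact_PiE_lessThan:
  assumes "compact (X :: 'a::topological_space set)"
  shows "compact (PiE {..<r::nat} (\<lambda>_. X))"
proof -
  have "PiE {..<r} (\<lambda>_. X) = PiE UNIV (\<lambda>i. if i < r then X else {undefined})"
    by (force simp: PiE_iff extensional_def split: if_splits)
  moreover have "compactin (product_topology (\<lambda>_. euclidean) UNIV) (PiE UNIV (\<lambda>i. if i < r then X else {undefined}))"
    unfolding compactin_PiE using assms by auto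
  ultimately show ?thesis
    by (simp add: euclidean_product_topology)
qed

lemma function_ring_on_product_sums:
  fixes X :: "'a::metric_space set"
  assumes "compact X" "1 \<le> r"
  shows "function_ring_on (product_sums X r) (PiE {..<r} (\<lambda>_. X))"
proof
  show "compact (PiE {..<r} (\<lambda>_. X))"
    by (rule compact_PiE_lessThan) fact
  show "continuous_on (PiE {..<r} (\<lambda>_. X)) f" if "f \<in> product_sums X r" for f
    using that
  proof induction
    case (prod f)
    have "continuous_on (PiE {..<r} (\<lambda>_. X)) (\<lambda>z. f k (z k))" if "k < r" for k
      by (rule continuous_on_compose2[OF prod[OF that] continuous_on_subset[OF continuous_on_product_coordinates]])
        (use that in auto)
    then show ?case
      by (intro continuous_intros) auto
  qed (intro continuous_intros)
  show "(\<lambda>_. c) \<in> product_sums X r" for c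
  proof -
    have "(\<lambda>z. \<Prod>k<r. (\<lambda>_. if k = 0 then c else 1) (z k)) \<in> product_sums X r"
      by (rule product_sums.prod) (intro continuous_intros)
    moreover have "(\<Prod>k<r. if k = 0 then c else 1) = c"
      using assms(2) by (subst prod.delta) auto
    ultimately show ?thesis by simp
  qed
  show "\<exists>f\<in>product_sums X r. f y \<noteq> f z"
    if yz: "y \<in> PiE {..<r} (\<lambda>_. X)" "z \<in> PiE {..<r} (\<lambda>_. X)" "y \<noteq> z" for y z
  proof -
    obtain l where l: "l < r" "y l \<noteq> z l"
      using PiE_ext[OF yz(1,2)] yz(3) by auto
    \<comment> \<open>The distance to \<open>y l\<close> in coordinate \<open>l\<close> alone: it
      vanishes at \<open>y\<close> but not at \<open>z\<close>.\<close>
    let ?f = "\<lambda>w. \<Prod>k<r. (\<lambda>u. if k = l then dist (y l) u else 1) (w k)"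
    have "?f \<in> product_sums X r"
    proof (rule product_sums.prod)
      show "continuous_on X (\<lambda>u. if k = l then dist (y l) u else 1)" for k
        by (cases "k = l") (auto intro!: continuous_intros)
    qed
    moreover have "?f y \<noteq> ?f z"
      using l by (simp add: prod.delta)
    ultimately show ?thesis by (intro bexI)
  qed
qed (use product_sums.add product_sums_mult in auto)

section \<open>Convergence of multiple averages\<close>

abbreviation multi_mean :: "('a \<Rightarrow> 'a) \<Rightarrow> 'a \<Rightarrow> nat \<Rightarrow> ((nat \<Rightarrow> 'a) \<Rightarrow> real) \<Rightarrow> nat \<Rightarrow> real" where
  "multi_mean T x r \<Phi> n \<equiv>
     (\<Sum>i\<in>PiE {..<r} (\<lambda>_. {1..n}). \<Phi> (\<lambda>k\<in>{..<r}. (T ^^ (i k)) x)) / real n ^ r"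

lemma multi_mean_bound:
  assumes "T ` X \<subseteq> X" "x \<in> X" and "\<And>z. z \<in> PiE {..<r} (\<lambda>_. X) \<Longrightarrow> \<bar>\<Phi> z\<bar> \<le> e"
  shows "\<bar>multi_mean T x r \<Phi> n\<bar> \<le> e"
proof -
  have e: "0 \<le> e"
    using assms(3)[of "\<lambda>k\<in>{..<r}. x"] assms(2) by fastforce
  have "\<bar>\<Sum>i\<in>PiE {..<r} (\<lambda>_. {1..n}). \<Phi> (\<lambda>k\<in>{..<r}. (T ^^ (i k)) x)\<bar> \<le> (\<Sum>i\<in>PiE {..<r} (\<lambda>_. {1..n}). e)"
    by (rule order_trans[OF sum_abs sum_mono]) (use funpow_mem[OF assms(1,2)] in \<open>auto intro!: assms(3)\<close>)
  also have "\<dots> = real n ^ r * e"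
    by (simp add: card_PiE)
  finally show ?thesis
    using e by (cases "real n ^ r = 0") (auto simp: field_simps)
qed

text \<open>The filter \<open>G\<close> lets one convergence theorem serve both directions:
  \<open>G = sequentially\<close> for generic points, and a cluster filter for arbitrary points of
  the level set.\<close>

locale weak_limit =
  fixes X :: "'a::metric_space set" and T :: "'a \<Rightarrow> 'a" and x :: 'a and G :: "nat filter" and \<mu> :: "'a measure"
  assumes compact: "compact X" and T_cont: "continuous_on X T" and T_into: "T ` X \<subseteq> X" and x: "x \<in> X"
    and G: "G \<le> sequentially" and inv: "\<mu> \<in> invariant_measures X T"
    and lim: "continuous_on X f \<Longrightarrow> (birkhoff_mean T x f \<longlongrightarrow> integral\<^sup>L \<mu> f) G"
begin

lemma sets: "sets \<mu> = sets (restrict_space borel X)"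
  using inv by (simp add: invariant_measures_def)

sublocale prob_space \<mu>
  using inv by (simp add: invariant_measures_def)

lemma space: "space \<mu> = X"
  using sets_eq_imp_space_eq[OF sets] by (simp add: space_restrict_space)

lemmas continuous_measurable = integrable_continuous_on_compact(1)[OF compact sets finite_measure_axioms]
  and continuous_integrable = integrable_continuous_on_compact(2)[OF compact sets finite_measure_axioms]

lemma T_measurable: "T \<in> measurable \<mu> \<mu>"
  by (rule measurable_continuous_self_map[OF T_cont T_into sets])

lemma mean_atLeast1_tendsto:
  assumes f: "continuous_on X f"
  shows "((\<lambda>n. (\<Sum>i=1..n. f ((T ^^ i) x)) / real n) \<longlongrightarrow> integral\<^sup>L \<mu> f) G"
proof -
  have "(\<Sum>i=1..n. f ((T ^^ i) x)) / real n
      = (birkhoff_mean T x (\<lambda>y. f (T y)) n - birkhoff_mean T x f n) + birkhoff_mean T x f n" for n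
    by (simp add: sum.atLeast1_atMost_eq)
  then show ?thesis
    using tendsto_add[OF tendsto_mono[OF G birkhoff_mean_shift_tendsto[OF compact T_into x f]] lim[OF f]]
    by (simp only: add_0)
qed

text \<open>Summing a product over a grid gives a product of one-dimensional sums, matching Fubini
  for the product measure. Integrability is carried along because the induction step splits the
  integral of a sum.\<close>

lemma product_sums_tendsto:
  assumes "g \<in> product_sums X r"
  shows "integrable (PiM {..<r} (\<lambda>_. \<mu>)) g \<and>
    (multi_mean T x r g \<longlongrightarrow> integral\<^sup>L (PiM {..<r} (\<lambda>_. \<mu>)) g) G"
  using assms
proof induction
  case (prod f)
  interpret P: product_sigma_finite "\<lambda>_::nat. \<mu>"
    by unfold_locales
  have "multi_mean T x r (\<lambda>z. \<Prod>k<r. f k (z k)) n = (\<Prod>k<r. (\<Sum>i=1..n. f k ((T ^^ i) x)) / real n)" for n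
    by (simp add: prod_dividef prod_sum_PiE)
  moreover have "((\<lambda>n. \<Prod>k<r. (\<Sum>i=1..n. f k ((T ^^ i) x)) / real n) \<longlongrightarrow> (\<Prod>k<r. integral\<^sup>L \<mu> (f k))) G"
    by (rule tendsto_prod) (rule mean_atLeast1_tendsto, use prod in simp)
  ultimately show ?case
    using P.product_integral_prod[of "{..<r}" f] P.product_integrable_prod[of "{..<r}" f]
      continuous_integrable prod by simp
next
  case (add g h)
  then have "((\<lambda>n. multi_mean T x r g n + multi_mean T x r h n) \<longlongrightarrow>
      integral\<^sup>L (PiM {..<r} (\<lambda>_. \<mu>)) g + integral\<^sup>L (PiM {..<r} (\<lambda>_. \<mu>)) h) G"
    by (intro tendsto_add) blast+
  with add show ?case
    by (simp add: sum.distrib add_divide_distrib del: restrict_apply)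
qed

theorem multi_mean_tendsto:
  assumes r: "1 \<le> r" and \<Phi>: "continuous_on (PiE {..<r} (\<lambda>_. X)) \<Phi>"
  shows "(multi_mean T x r \<Phi> \<longlongrightarrow> integral\<^sup>L (PiM {..<r} (\<lambda>_. \<mu>)) \<Phi>) G"
proof -
  let ?S = "PiE {..<r} (\<lambda>_. X)" and ?P = "PiM {..<r} (\<lambda>_. \<mu>)"
  interpret R: function_ring_on "product_sums X r" ?S
    by (rule function_ring_on_product_sums[OF compact r])
  interpret P: prob_space ?P
    by (intro prob_space_PiM prob_space_axioms)
  have space_P: "space ?P = ?S"
    by (simp add: space_PiM space)
  have "\<exists>g\<in>product_sums X r. \<forall>z\<in>?S. \<bar>\<Phi> z - g z\<bar> < 1 / real (Suc m)" for m
    by (rule R.Stone_Weierstrass_basic[OF \<Phi>]) simp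
  then obtain g where g: "\<And>m. g m \<in> product_sums X r"
    "\<And>m z. z \<in> ?S \<Longrightarrow> \<bar>\<Phi> z - g m z\<bar> < 1 / real (Suc m)"
    by metis
  \<comment> \<open>The measure lives on the product sigma-algebra, whereas \<open>\<Phi>\<close> is
    only known to be continuous; measurability comes from being a pointwise limit of product
    sums.\<close>
  have "\<Phi> \<in> borel_measurable ?P"
  proof (rule borel_measurable_LIMSEQ_real)
    show "g m \<in> borel_measurable ?P" for m
      using product_sums_tendsto[OF g(1)[of m]] by auto
    fix z assume "z \<in> space ?P"
    then have "norm (g m z - \<Phi> z) \<le> 1 / real (Suc m)" for m
      using g(2)[of z m] by (simp add: space_P abs_minus_commute)
    then have "(\<lambda>m. g m z - \<Phi> z) \<longlonglongrightarrow> 0"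
      by (intro Lim_null_comparison[OF _ LIMSEQ_inverse_real_of_nat] always_eventually allI)
        (simp add: inverse_eq_divide)
    then show "(\<lambda>m. g m z) \<longlonglongrightarrow> \<Phi> z"
      by (simp add: LIM_zero_iff)
  qed
  moreover obtain B where "\<And>z. z \<in> ?S \<Longrightarrow> norm (\<Phi> z) \<le> B"
    using compact_imp_bounded[OF compact_continuous_image[OF \<Phi> R.compact]]
    by (auto simp: bounded_iff)
  ultimately have int: "integrable ?P \<Phi>"
    by (intro P.integrable_const_bound[of _ B]) (auto simp: space_P intro!: AE_I2)
  show ?thesis
  proof (rule tendstoI)
    fix e :: real assume "0 < e"
    then obtain m where "inverse (real (Suc m)) < e / 3"
      using reals_Archimedean[of "e / 3"] by auto
    then have m: "1 / real (Suc m) < e / 3"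
      by (simp add: inverse_eq_divide)
    have gm: "integrable ?P (g m)" "(multi_mean T x r (g m) \<longlongrightarrow> integral\<^sup>L ?P (g m)) G"
      using product_sums_tendsto[OF g(1)[of m]] by auto
    have 1: "\<bar>multi_mean T x r \<Phi> n - multi_mean T x r (g m) n\<bar> < e / 3" for n
    proof -
      have "\<bar>multi_mean T x r (\<lambda>z. \<Phi> z - g m z) n\<bar> \<le> 1 / real (Suc m)"
        by (rule multi_mean_bound[OF T_into x]) (use g(2) in \<open>auto intro: less_imp_le\<close>)
      then show ?thesis
        using m by (simp only: sum_subtractf diff_divide_distrib)
    qed
    have 2: "\<bar>integral\<^sup>L ?P \<Phi> - integral\<^sup>L ?P (g m)\<bar> < e / 3"
    proof -
      have "\<bar>integral\<^sup>L ?P (\<lambda>z. \<Phi> z - g m z)\<bar> \<le> integral\<^sup>L ?P (\<lambda>z. \<bar>\<Phi> z - g m z\<bar>)"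
        by (rule integral_abs_bound)
      also have "\<dots> \<le> integral\<^sup>L ?P (\<lambda>_. 1 / real (Suc m))"
        by (rule integral_mono) (use int gm(1) g(2) in \<open>auto simp: space_P intro: less_imp_le\<close>)
      finally show ?thesis
        using m int gm(1) by (simp add: P.prob_space)
    qed
    have "\<forall>\<^sub>F n in G. dist (multi_mean T x r (g m) n) (integral\<^sup>L ?P (g m)) < e / 3"
      by (rule tendstoD[OF gm(2)]) (use \<open>0 < e\<close> in simp)
    then show "\<forall>\<^sub>F n in G. dist (multi_mean T x r \<Phi> n) (integral\<^sup>L ?P \<Phi>) < e"
    proof eventually_elim
      case (elim n)
      then show ?case
        using 1[of n] 2 unfolding dist_real_def by linarith
    qed
  qed
qed

end

text \<open>Convergence to \<open>\<alpha>\<close> persists along \<open>G\<close>, so uniqueness of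
  limits identifies the integral. This gives the emptiness claim as well as the measures for the
  upper bound.\<close>

lemma level_set_E_weak_limit:
  assumes "compact X" "continuous_on X T" "T ` X \<subseteq> X" "1 \<le> r" "continuous_on (PiE {..<r} (\<lambda>_. X)) \<Phi>"
    and x: "x \<in> level_set_E X T r \<Phi> \<alpha>"
  obtains G \<mu> where "weak_limit X T x G \<mu>" "G \<noteq> bot" "\<mu> \<in> level_measures X T r \<Phi> \<alpha>"
proof -
  have "x \<in> X" and conv: "multi_mean T x r \<Phi> \<longlonglongrightarrow> \<alpha>"
    using x by (auto simp: level_set_E_def)
  obtain G \<mu> where H: "G \<noteq> bot" "G \<le> sequentially" "\<mu> \<in> invariant_measures X T"
    "\<And>f. continuous_on X f \<Longrightarrow> (birkhoff_mean T x f \<longlongrightarrow> integral\<^sup>L \<mu> f) G"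
    using empirical_measures_cluster[OF assms(1-3) \<open>x \<in> X\<close>] by blast
  interpret weak_limit X T x G \<mu>
    by unfold_locales (use assms H \<open>x \<in> X\<close> in auto)
  have "integral\<^sup>L (PiM {..<r} (\<lambda>_. \<mu>)) \<Phi> = \<alpha>"
    by (rule tendsto_unique[OF H(1) multi_mean_tendsto[OF assms(4,5)] tendsto_mono[OF H(2) conv]])
  then show ?thesis
    using that weak_limit_axioms H by (simp add: level_measures_def)
qed

lemma generic_points_subset_level_set_E:
  assumes "compact X" "continuous_on X T" "T ` X \<subseteq> X" "1 \<le> r" "continuous_on (PiE {..<r} (\<lambda>_. X)) \<Phi>"
    and \<mu>: "\<mu> \<in> level_measures X T r \<Phi> \<alpha>"
  shows "generic_points X T \<mu> \<subseteq> level_set_E X T r \<Phi> \<alpha>"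
proof
  fix x assume x: "x \<in> generic_points X T \<mu>"
  interpret weak_limit X T x sequentially \<mu>
    by unfold_locales (use assms x in \<open>auto simp: generic_points_def level_measures_def\<close>)
  show "x \<in> level_set_E X T r \<Phi> \<alpha>"
    using multi_mean_tendsto[OF assms(4,5)] x \<mu>
    by (simp add: level_set_E_def level_measures_def generic_points_def)
qed

section \<open>Subadditivity, words and itineraries\<close>

text \<open>\<open>entropy_rel\<close> is defined through \<open>lim\<close>, which carries
  information only if the sequence converges. The limit is the infimum \<open>l\<close>, a real
  number by nonnegativity.\<close>

lemma fekete:
  fixes u :: "nat \<Rightarrow> real"
  assumes sub: "\<And>m n. u (m + n) \<le> u m + u n" and nn: "\<And>n. 0 \<le> u n"
  shows "convergent (\<lambda>n. u n / real n)"
proof -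
  define l where "l = (INF n\<in>{1..}. u n / real n)"
  have bdd: "bdd_below ((\<lambda>n. u n / real n) ` {1..})"
    by (rule bdd_belowI2[of _ 0]) (simp add: nn)
  have "(\<lambda>n. u n / real n) \<longlonglongrightarrow> l"
  proof (rule LIMSEQ_I)
    fix e :: real assume e: "0 < e"
    have "l < l + e / 2" using e by simp
    then obtain m where m: "1 \<le> m" "u m / real m < l + e / 2"
      using cINF_less_iff[OF _ bdd, of "l + e / 2"] by (auto simp: l_def)
    \<comment> \<open>One bound for every remainder \<open>u (n mod m)\<close>; it disappears after
      division by \<open>n\<close>.\<close>
    define C where "C = (\<Sum>s<m. u s)"
    have mult: "u (q * m + s) \<le> real q * u m + u s" for q s
    proof (induction q)
      case (Suc q)
      then show ?case
        using sub[of m "q * m + s"] by (simp add: algebra_simps)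
    qed simp
    have le: "u n / real n \<le> u m / real m + C / real n" if "1 \<le> n" for n
    proof -
      have "u n \<le> real (n div m) * u m + u (n mod m)"
        using mult[of "n div m" "n mod m"] by simp
      also have "u (n mod m) \<le> C"
        unfolding C_def by (rule member_le_sum) (use m nn in auto)
      also have "real (n div m) * u m \<le> (real n / real m) * u m"
        by (rule mult_right_mono[OF of_nat_div_le_of_nat nn])
      finally show ?thesis
        using that m by (simp add: field_simps)
    qed
    obtain N where N: "2 * C / e < real N" 
      using reals_Archimedean2 by blast
    have "norm (u n / real n - l) < e" if "max 1 N \<le> n" for n
    proof -
      have "2 * C / e < real n"
        using N that by linarith
      then have "C / real n < e / 2"
        using e that by (simp add: field_simps)
      moreover have "l \<le> u n / real n"
        unfolding l_def by (rule cINF_lower[OF bdd]) (use that in auto)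
      ultimately show ?thesis
        using le[of n] m(2) that unfolding real_norm_def by linarith
    qed
    then show "\<exists>no. \<forall>n\<ge>no. norm (u n / real n - l) < e"
      by blast
  qed
  then show ?thesis
    by (rule convergentI)
qed

text \<open>Gibbs' inequality, termwise from \<open>ln x \<le> x - 1\<close>. Positivity of
  \<open>s i\<close> matters only where \<open>q i\<close> is positive, the other terms being
  multiplied by 0.\<close>

lemma cross_entropy_ge:
  fixes q s :: "'b \<Rightarrow> real"
  assumes "\<And>i. i \<in> A \<Longrightarrow> 0 \<le> q i" "\<And>i. i \<in> A \<Longrightarrow> 0 \<le> s i"
    and "\<And>i. i \<in> A \<Longrightarrow> 0 < q i \<Longrightarrow> 0 < s i" and "(\<Sum>i\<in>A. s i) \<le> (\<Sum>i\<in>A. q i)"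
  shows "- (\<Sum>i\<in>A. q i * ln (q i)) \<le> - (\<Sum>i\<in>A. q i * ln (s i))"
proof -
  have "q i * ln (s i) - q i * ln (q i) \<le> s i - q i" if i: "i \<in> A" for i
  proof (cases "q i = 0")
    case True
    then show ?thesis using assms(2)[OF i] by simp
  next
    case False
    then have pos: "0 < q i" "0 < s i"
      using assms(1,3)[OF i] by auto
    then have "ln (s i / q i) \<le> s i / q i - 1"
      by (intro ln_le_minus_one) simp
    then have "q i * ln (s i / q i) \<le> q i * (s i / q i - 1)"
      using pos by (intro mult_left_mono) auto
    then show ?thesis
      using pos by (simp add: ln_div algebra_simps)
  qed
  then have "(\<Sum>i\<in>A. q i * ln (s i) - q i * ln (q i)) \<le> (\<Sum>i\<in>A. s i - q i)"
    by (rule sum_mono)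
  then show ?thesis
    using assms(4) by (simp add: sum_subtractf)
qed

definition words :: "nat \<Rightarrow> nat \<Rightarrow> nat list set" where
  "words L n = {v. set v \<subseteq> {..<L} \<and> length v = n}"

lemma finite_words: "finite (words L n)"
  unfolding words_def by (rule finite_lists_length_eq) simp

lemma card_words: "card (words L n) = L ^ n"
  unfolding words_def by (subst card_lists_length_eq) auto

lemma sum_words_append:
  "(\<Sum>w\<in>words L (n + m). f w) = (\<Sum>u\<in>words L n. \<Sum>v\<in>words L m. f (u @ v))"
proof -
  have "(\<Sum>w\<in>words L (n + m). f w) = (\<Sum>(u,v)\<in>words L n \<times> words L m. f (u @ v))"
  proof (rule sum.reindex_bij_witness[of _ "\<lambda>(u,v). u @ v" "\<lambda>w. (take n w, drop n w)"])
    fix w assume "w \<in> words L (n + m)"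
    then show "(take n w, drop n w) \<in> words L n \<times> words L m"
      by (auto simp: words_def dest: in_set_takeD in_set_dropD)
  qed (auto simp: words_def)
  then show ?thesis
    by (simp add: sum.cartesian_product)
qed

definition itinerary :: "('a \<Rightarrow> 'a) \<Rightarrow> ('a \<Rightarrow> nat) \<Rightarrow> nat \<Rightarrow> 'a \<Rightarrow> nat list" where
  "itinerary T a n y = map (\<lambda>i. a ((T ^^ i) y)) [0..<n]"

lemma length_itinerary [simp]: "length (itinerary T a n y) = n"
  by (simp add: itinerary_def)

lemma itinerary_0 [simp]: "itinerary T a 0 y = []"
  by (simp add: itinerary_def)

lemma itinerary_nth: "i < n \<Longrightarrow> itinerary T a n y ! i = a ((T ^^ i) y)"
  by (simp add: itinerary_def)

lemma itinerary_add: "itinerary T a (n + m) y = itinerary T a n y @ itinerary T a m ((T ^^ n) y)"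
  by (rule nth_equalityI) (auto simp: itinerary_nth nth_append funpow_add[symmetric] simp flip: comp_apply[of "T ^^ _"])

lemma itinerary_Suc: "itinerary T a (Suc n) y = a y # itinerary T a n (T y)"
  using itinerary_add[of T a 1 n y] by (simp add: itinerary_def)

section \<open>Jordan measurable sets and visit frequencies\<close>

context weak_limit
begin

lemma vimage_funpow_sets:
  assumes "A \<in> sets \<mu>"
  shows "(T ^^ n) -` A \<inter> X \<in> sets \<mu>" "measure \<mu> ((T ^^ n) -` A \<inter> X) = measure \<mu> A"
proof -
  have "(T ^^ n) -` A \<inter> X \<in> sets \<mu> \<and> emeasure \<mu> ((T ^^ n) -` A \<inter> X) = emeasure \<mu> A"
  proof (induction n)
    case 0
    have "A \<inter> X = A"
      using sets.sets_into_space[OF assms] by (auto simp: space)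
    then show ?case using assms by simp
  next
    case (Suc n)
    have eq: "(T ^^ Suc n) -` A \<inter> X = T -` ((T ^^ n) -` A \<inter> X) \<inter> X"
      using T_into by (auto simp: funpow_swap1)
    have "T -` ((T ^^ n) -` A \<inter> X) \<inter> X \<in> sets \<mu>"
      using measurable_sets[OF T_measurable, of "(T ^^ n) -` A \<inter> X"] Suc by (simp add: space)
    moreover have "emeasure \<mu> (T -` ((T ^^ n) -` A \<inter> X) \<inter> X) = emeasure \<mu> ((T ^^ n) -` A \<inter> X)"
      using inv Suc unfolding invariant_measures_def by blast
    ultimately show ?case
      using Suc unfolding eq by simp
  qed
  then show "(T ^^ n) -` A \<inter> X \<in> sets \<mu>" "measure \<mu> ((T ^^ n) -` A \<inter> X) = measure \<mu> A"
    by (simp_all add: measure_def)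
qed

text \<open>Weak-star convergence controls the visit frequencies only for sets whose boundary is null; being
  squeezed between continuous functions is the form of this condition that passes easily to
  intersections, complements and preimages.\<close>

definition jordan_set :: "'a set \<Rightarrow> bool" where
  "jordan_set A \<longleftrightarrow> A \<in> sets \<mu> \<and>
     (\<forall>e>0. \<exists>f g :: 'a \<Rightarrow> real. continuous_on X f \<and> continuous_on X g \<and>
        (\<forall>y\<in>X. 0 \<le> f y \<and> f y \<le> indicator A y \<and> indicator A y \<le> g y \<and> g y \<le> 1) \<and>
        integral\<^sup>L \<mu> g - integral\<^sup>L \<mu> f < e)"

lemma jordan_setE:
  fixes e :: real
  assumes "jordan_set A" "0 < e"
  obtains f g where "continuous_on X f" "continuous_on X g"
    "\<And>y. y \<in> X \<Longrightarrow> 0 \<le> f y" "\<And>y. y \<in> X \<Longrightarrow> f y \<le> indicator A y"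
    "\<And>y. y \<in> X \<Longrightarrow> indicator A y \<le> g y" "\<And>y. y \<in> X \<Longrightarrow> g y \<le> 1"
    "integral\<^sup>L \<mu> g - integral\<^sup>L \<mu> f < e"
  using assms unfolding jordan_set_def by blast

lemma jordan_set_sets: "jordan_set A \<Longrightarrow> A \<in> sets \<mu>"
  by (simp add: jordan_set_def)

lemma jordan_set_space: "jordan_set X"
  unfolding jordan_set_def
proof (intro conjI allI impI)
  show "X \<in> sets \<mu>"
    using sets.top[of \<mu>] by (simp add: space)
  fix e :: real assume "0 < e"
  then show "\<exists>f g :: 'a \<Rightarrow> real. continuous_on X f \<and> continuous_on X g \<and>
        (\<forall>y\<in>X. 0 \<le> f y \<and> f y \<le> indicator X y \<and> indicator X y \<le> g y \<and> g y \<le> 1) \<and>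
        integral\<^sup>L \<mu> g - integral\<^sup>L \<mu> f < e"
    by (intro exI[of _ "\<lambda>_. 1"]) auto
qed

lemma jordan_set_Diff:
  assumes "jordan_set A"
  shows "jordan_set (X - A)"
  unfolding jordan_set_def
proof (intro conjI allI impI)
  show "X - A \<in> sets \<mu>"
    using sets.compl_sets[OF jordan_set_sets[OF assms]] by (simp add: space)
  fix e :: real assume "0 < e"
  from jordan_setE[OF assms this] obtain f g where fg: "continuous_on X f" "continuous_on X g"
    "\<And>y. y \<in> X \<Longrightarrow> 0 \<le> f y" "\<And>y. y \<in> X \<Longrightarrow> f y \<le> indicator A y"
    "\<And>y. y \<in> X \<Longrightarrow> indicator A y \<le> g y" "\<And>y. y \<in> X \<Longrightarrow> g y \<le> 1"
    "integral\<^sup>L \<mu> g - integral\<^sup>L \<mu> f < e" by metis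
  have ind: "indicator (X - A) y = 1 - (indicator A y :: real)" if "y \<in> X" for y
    using that by (auto simp: indicator_def)
  have "integral\<^sup>L \<mu> (\<lambda>y. 1 - f y) - integral\<^sup>L \<mu> (\<lambda>y. 1 - g y) < e"
    using fg by (simp add: continuous_integrable prob_space)
  then show "\<exists>f g :: 'a \<Rightarrow> real. continuous_on X f \<and> continuous_on X g \<and>
        (\<forall>y\<in>X. 0 \<le> f y \<and> f y \<le> indicator (X - A) y \<and> indicator (X - A) y \<le> g y \<and> g y \<le> 1) \<and>
        integral\<^sup>L \<mu> g - integral\<^sup>L \<mu> f < e"
    using fg by (intro exI[of _ "\<lambda>y. 1 - g y"] exI[of _ "\<lambda>y. 1 - f y"])
      (auto intro!: continuous_intros simp: ind)
qed

lemma jordan_set_Int: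
  assumes "jordan_set A" "jordan_set B"
  shows "jordan_set (A \<inter> B)"
  unfolding jordan_set_def
proof (intro conjI allI impI)
  show "A \<inter> B \<in> sets \<mu>"
    using assms by (simp add: jordan_set_sets sets.Int)
  fix e :: real assume "0 < e"
  then have e: "0 < e / 2" by simp
  from jordan_setE[OF assms(1) e] obtain f g where fg: "continuous_on X f" "continuous_on X g"
    "\<And>y. y \<in> X \<Longrightarrow> 0 \<le> f y" "\<And>y. y \<in> X \<Longrightarrow> f y \<le> indicator A y"
    "\<And>y. y \<in> X \<Longrightarrow> indicator A y \<le> g y" "\<And>y. y \<in> X \<Longrightarrow> g y \<le> 1"
    "integral\<^sup>L \<mu> g - integral\<^sup>L \<mu> f < e / 2" by metis
  from jordan_setE[OF assms(2) e] obtain f' g' where fg': "continuous_on X f'" "continuous_on X g'"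
    "\<And>y. y \<in> X \<Longrightarrow> 0 \<le> f' y" "\<And>y. y \<in> X \<Longrightarrow> f' y \<le> indicator B y"
    "\<And>y. y \<in> X \<Longrightarrow> indicator B y \<le> g' y" "\<And>y. y \<in> X \<Longrightarrow> g' y \<le> 1"
    "integral\<^sup>L \<mu> g' - integral\<^sup>L \<mu> f' < e / 2" by metis
  let ?f = "\<lambda>y. f y * f' y" and ?g = "\<lambda>y. g y * g' y"
  have f: "f y \<le> 1" "f' y \<le> 1" and g: "0 \<le> g y" "0 \<le> g' y" if "y \<in> X" for y
    using fg(4,5)[OF that] fg'(4,5)[OF that] by (cases "y \<in> A"; cases "y \<in> B"; simp)+
  have cont: "continuous_on X ?f" "continuous_on X ?g"
    by (intro continuous_intros fg fg')+
  have "integral\<^sup>L \<mu> ?g - integral\<^sup>L \<mu> ?f = integral\<^sup>L \<mu> (\<lambda>y. ?g y - ?f y)"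
    using cont by (simp add: continuous_integrable)
  also have "\<dots> \<le> integral\<^sup>L \<mu> (\<lambda>y. (g y - f y) + (g' y - f' y))"
  proof (rule integral_mono)
    fix y assume "y \<in> space \<mu>"
    then have y: "y \<in> X" by (simp add: space)
    have fg_le: "f y \<le> g y" "f' y \<le> g' y"
      using fg(4,5)[OF y] fg'(4,5)[OF y] by auto
    have "?g y - ?f y = (g y - f y) * g' y + f y * (g' y - f' y)"
      by (simp add: algebra_simps)
    also have "\<dots> \<le> (g y - f y) * 1 + 1 * (g' y - f' y)"
      using fg_le f[OF y] fg'(6)[OF y] by (intro add_mono mult_left_mono mult_right_mono) auto
    finally show "?g y - ?f y \<le> (g y - f y) + (g' y - f' y)"
      by simp
  qed (use cont fg fg' in \<open>auto intro!: continuous_integrable continuous_intros\<close>)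
  also have "\<dots> < e"
    using fg(7) fg'(7) by (simp add: continuous_integrable fg fg')
  finally have lt: "integral\<^sup>L \<mu> ?g - integral\<^sup>L \<mu> ?f < e" .
  have "0 \<le> ?f y \<and> ?f y \<le> indicator (A \<inter> B) y \<and> indicator (A \<inter> B) y \<le> ?g y \<and> ?g y \<le> 1"
    if y: "y \<in> X" for y
    unfolding indicator_inter_arith
    using fg(3-6)[OF y] fg'(3-6)[OF y] f[OF y] g[OF y]
    by (auto intro!: mult_mono mult_le_one)
  then show "\<exists>f g :: 'a \<Rightarrow> real. continuous_on X f \<and> continuous_on X g \<and>
        (\<forall>y\<in>X. 0 \<le> f y \<and> f y \<le> indicator (A \<inter> B) y \<and> indicator (A \<inter> B) y \<le> g y \<and> g y \<le> 1) \<and>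
        integral\<^sup>L \<mu> g - integral\<^sup>L \<mu> f < e"
    using cont lt by blast
qed

lemma integral_comp_T:
  assumes f: "continuous_on X f"
  shows "integral\<^sup>L \<mu> (\<lambda>y. f (T y)) = (integral\<^sup>L \<mu> f :: real)"
proof -
  have "distr \<mu> \<mu> T = \<mu>"
  proof (rule measure_eqI)
    fix A assume "A \<in> sets (distr \<mu> \<mu> T)"
    then show "emeasure (distr \<mu> \<mu> T) A = emeasure \<mu> A"
      using inv by (simp add: emeasure_distr[OF T_measurable] space invariant_measures_def)
  qed simp
  then show ?thesis
    using integral_distr[OF T_measurable continuous_measurable[OF f]] by simp
qed

lemma jordan_set_vimage:
  assumes "jordan_set A"
  shows "jordan_set (T -` A \<inter> X)"
  unfolding jordan_set_def
proof (intro conjI allI impI)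
  show "T -` A \<inter> X \<in> sets \<mu>"
    using vimage_funpow_sets(1)[OF jordan_set_sets[OF assms], of 1] by simp
  fix e :: real assume "0 < e"
  from jordan_setE[OF assms this] obtain f g where fg: "continuous_on X f" "continuous_on X g"
    "\<And>y. y \<in> X \<Longrightarrow> 0 \<le> f y" "\<And>y. y \<in> X \<Longrightarrow> f y \<le> indicator A y"
    "\<And>y. y \<in> X \<Longrightarrow> indicator A y \<le> g y" "\<And>y. y \<in> X \<Longrightarrow> g y \<le> 1"
    "integral\<^sup>L \<mu> g - integral\<^sup>L \<mu> f < e" by metis
  have TX: "T y \<in> X" if "y \<in> X" for y
    using T_into that by auto
  have ind: "indicator (T -` A \<inter> X) y = (indicator A (T y) :: real)" if "y \<in> X" for y
    using that by (auto simp: indicator_def)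
  have "continuous_on X (\<lambda>y. f (T y))" "continuous_on X (\<lambda>y. g (T y))"
    using continuous_on_compose2[OF fg(1) T_cont T_into] continuous_on_compose2[OF fg(2) T_cont T_into] .
  then show "\<exists>f g :: 'a \<Rightarrow> real. continuous_on X f \<and> continuous_on X g \<and>
        (\<forall>y\<in>X. 0 \<le> f y \<and> f y \<le> indicator (T -` A \<inter> X) y \<and> indicator (T -` A \<inter> X) y \<le> g y \<and> g y \<le> 1) \<and>
        integral\<^sup>L \<mu> g - integral\<^sup>L \<mu> f < e"
    using fg by (intro exI[of _ "\<lambda>y. f (T y)"] exI[of _ "\<lambda>y. g (T y)"]) (auto simp: ind TX integral_comp_T)
qed

text \<open>\<open>f k\<close> and \<open>g k\<close> are ramps of slope \<open>k\<close> inside and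
  outside the sphere. Their difference tends to the indicator of the sphere, whose integral is 0 by
  assumption.\<close>

lemma jordan_set_ball:
  assumes null: "measure \<mu> {y\<in>X. dist c y = r} = 0"
  shows "jordan_set {y\<in>X. dist c y < r}"
proof -
  define f where "f k y = max 0 (min 1 (real k * (r - dist c y)))" for k :: nat and y
  define g where "g k y = max 0 (min 1 (1 - real k * (dist c y - r)))" for k :: nat and y
  have cont: "continuous_on X (f k)" "continuous_on X (g k)" for k
    unfolding f_def g_def by (intro continuous_intros)+
  have d: "(\<lambda>y. dist c y) \<in> borel_measurable \<mu>"
    by (rule continuous_measurable) (intro continuous_intros)
  have S: "{y\<in>X. dist c y = r} \<in> sets \<mu>" "{y\<in>X. dist c y < r} \<in> sets \<mu>"
    using measurable_sets[OF d, of "{r}"] measurable_sets[OF d, of "{..<r}"]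
    by (simp_all add: space vimage_def Int_def conj_commute)
  have lim0: "(\<lambda>k. g k y - f k y) \<longlonglongrightarrow> indicator {y\<in>X. dist c y = r} y" if "y \<in> X" for y
  proof -
    consider "dist c y = r" | "dist c y < r" | "r < dist c y" by linarith
    then show ?thesis
    proof cases
      case 1
      then show ?thesis using that by (simp add: f_def g_def)
    next
      case 2
      then have "\<forall>\<^sub>F k in sequentially. 1 \<le> real k * (r - dist c y)"
        by (intro eventually_one_le_mult) simp
      then have "\<forall>\<^sub>F k in sequentially. g k y - f k y = 0"
        by eventually_elim (auto simp: f_def g_def min_def max_def algebra_simps)
      then show ?thesis
        using 2 by (simp add: tendsto_eventually)
    next
      case 3
      then have "\<forall>\<^sub>F k in sequentially. 1 \<le> real k * (dist c y - r)"
        by (intro eventually_one_le_mult) simp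
      then have "\<forall>\<^sub>F k in sequentially. g k y - f k y = 0"
        by eventually_elim (auto simp: f_def g_def min_def max_def algebra_simps)
      then show ?thesis
        using 3 by (simp add: tendsto_eventually)
    qed
  qed
  have "(\<lambda>k. integral\<^sup>L \<mu> (\<lambda>y. g k y - f k y)) \<longlonglongrightarrow> integral\<^sup>L \<mu> (indicator {y\<in>X. dist c y = r} :: 'a \<Rightarrow> real)"
  proof (rule integral_dominated_convergence[where w="\<lambda>_. 1"])
    show "(\<lambda>y. g k y - f k y) \<in> borel_measurable \<mu>" for k
      by (intro continuous_measurable continuous_intros cont)
    show "AE y in \<mu>. (\<lambda>k. g k y - f k y) \<longlonglongrightarrow> indicator {y\<in>X. dist c y = r} y"
      by (rule AE_I2) (simp add: lim0 space)
    have "\<bar>g k y - f k y\<bar> \<le> 1" for k y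
      unfolding f_def g_def by (auto simp: min_def max_def)
    then show "AE y in \<mu>. norm (g k y - f k y) \<le> 1" for k
      by (intro AE_I2) simp
  qed (use S in auto)
  then have lim: "(\<lambda>k. integral\<^sup>L \<mu> (g k) - integral\<^sup>L \<mu> (f k)) \<longlonglongrightarrow> 0"
    using S null by (simp add: continuous_integrable cont)
  show ?thesis
    unfolding jordan_set_def
  proof (intro conjI allI impI S)
    fix e :: real assume "0 < e"
    then obtain k where "integral\<^sup>L \<mu> (g k) - integral\<^sup>L \<mu> (f k) < e"
      using order_tendstoD(2)[OF lim] by (auto simp: eventually_sequentially)
    moreover have "0 \<le> f k y \<and> f k y \<le> indicator {y\<in>X. dist c y < r} y \<and>
        indicator {y\<in>X. dist c y < r} y \<le> g k y \<and> g k y \<le> 1" if "y \<in> X" for y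
      using that mult_nonneg_nonpos[of "real k" "r - dist c y"] mult_nonneg_nonpos[of "real k" "dist c y - r"]
      unfolding f_def g_def indicator_def by (auto simp: min.coboundedI2)
    ultimately show "\<exists>f g :: 'a \<Rightarrow> real. continuous_on X f \<and> continuous_on X g \<and>
        (\<forall>y\<in>X. 0 \<le> f y \<and> f y \<le> indicator {y\<in>X. dist c y < r} y \<and>
          indicator {y\<in>X. dist c y < r} y \<le> g y \<and> g y \<le> 1) \<and>
        integral\<^sup>L \<mu> g - integral\<^sup>L \<mu> f < e"
      using cont by blast
  qed
qed

lemma frequency_tendsto:
  assumes A: "jordan_set A"
  shows "(birkhoff_mean T x (indicator A) \<longlongrightarrow> measure \<mu> A) G"
proof (rule tendstoI)
  fix e :: real assume "0 < e"
  then have e: "0 < e / 2" by simp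
  from jordan_setE[OF A e] obtain f g where fg: "continuous_on X f" "continuous_on X g"
    "\<And>y. y \<in> X \<Longrightarrow> 0 \<le> f y" "\<And>y. y \<in> X \<Longrightarrow> f y \<le> indicator A y"
    "\<And>y. y \<in> X \<Longrightarrow> indicator A y \<le> g y" "\<And>y. y \<in> X \<Longrightarrow> g y \<le> 1"
    "integral\<^sup>L \<mu> g - integral\<^sup>L \<mu> f < e / 2" by metis
  have A_int: "integral\<^sup>L \<mu> (indicator A) = measure \<mu> A" "integrable \<mu> (indicator A :: 'a \<Rightarrow> real)"
    using jordan_set_sets[OF A] sets.Int_space_eq2[OF jordan_set_sets[OF A]] by (auto simp: less_top[symmetric])
  have "integral\<^sup>L \<mu> f \<le> integral\<^sup>L \<mu> (indicator A)" "integral\<^sup>L \<mu> (indicator A) \<le> integral\<^sup>L \<mu> g"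
    by (intro integral_mono A_int continuous_integrable fg, use fg in \<open>simp add: space\<close>)+
  then have le: "integral\<^sup>L \<mu> f \<le> measure \<mu> A" "measure \<mu> A \<le> integral\<^sup>L \<mu> g"
    unfolding A_int .
  have "\<forall>\<^sub>F n in G. dist (birkhoff_mean T x f n) (integral\<^sup>L \<mu> f) < e / 2"
    "\<forall>\<^sub>F n in G. dist (birkhoff_mean T x g n) (integral\<^sup>L \<mu> g) < e / 2"
    by (intro tendstoD lim fg e)+
  then show "\<forall>\<^sub>F n in G. dist (birkhoff_mean T x (indicator A) n) (measure \<mu> A) < e"
  proof eventually_elim
    case (elim n)
    have "birkhoff_mean T x f n \<le> birkhoff_mean T x (indicator A) n"
      "birkhoff_mean T x (indicator A) n \<le> birkhoff_mean T x g n"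
      by (intro divide_right_mono sum_mono fg funpow_mem[OF T_into x]; simp)+
    then show ?case
      using elim le fg(7) unfolding dist_real_def by linarith
  qed
qed

end

section \<open>Entropy of a coding\<close>

locale coded_weak_limit = weak_limit +
  fixes a :: "'a \<Rightarrow> nat" and L :: nat
  assumes code_less: "y \<in> X \<Longrightarrow> a y < L"
    and code_jordan: "i < L \<Longrightarrow> jordan_set {y\<in>X. a y = i}"
begin

definition cylinder :: "nat list \<Rightarrow> 'a set" where
  "cylinder v = {y\<in>X. itinerary T a (length v) y = v}"

definition block_entropy :: "nat \<Rightarrow> real" where
  "block_entropy n = - (\<Sum>v\<in>words L n. prob (cylinder v) * ln (prob (cylinder v)))"

lemma itinerary_in_words: "y \<in> X \<Longrightarrow> itinerary T a n y \<in> words L n"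
  by (auto simp: words_def itinerary_def intro!: code_less funpow_mem[OF T_into])

lemma cylinder_Nil: "cylinder [] = X"
  by (auto simp: cylinder_def)

lemma cylinder_append: "cylinder (u @ v) = cylinder u \<inter> ((T ^^ length u) -` cylinder v \<inter> X)"
  using funpow_mem[OF T_into] by (auto simp: cylinder_def itinerary_add append_eq_append_conv)

lemma cylinder_Cons: "cylinder (i # v) = {y\<in>X. a y = i} \<inter> (T -` cylinder v \<inter> X)"
  using T_into by (auto simp: cylinder_def itinerary_Suc)

lemma jordan_cylinder: "set v \<subseteq> {..<L} \<Longrightarrow> jordan_set (cylinder v)"
proof (induction v)
  case (Cons i v)
  then show ?case
    unfolding cylinder_Cons by (intro jordan_set_Int jordan_set_vimage code_jordan) auto
qed (simp add: cylinder_Nil jordan_set_space)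

lemma sets_cylinder: "v \<in> words L n \<Longrightarrow> cylinder v \<in> events"
  by (auto simp: words_def intro: jordan_set_sets jordan_cylinder)

text \<open>Total probability over the word read at times \<open>n\<close> to
  \<open>n + m - 1\<close>. A cylinder for \<open>A\<close> gives the left marginal of concatenated
  words; \<open>n = 0\<close> with a preimage for \<open>A\<close> gives the right one.\<close>

lemma sum_prob_cylinder:
  assumes A: "A \<in> events"
  shows "(\<Sum>v\<in>words L m. prob (A \<inter> ((T ^^ n) -` cylinder v \<inter> X))) = prob A"
proof -
  have "prob (\<Union>v\<in>words L m. A \<inter> ((T ^^ n) -` cylinder v \<inter> X))
      = (\<Sum>v\<in>words L m. prob (A \<inter> ((T ^^ n) -` cylinder v \<inter> X)))"
  proof (rule finite_measure_finite_Union)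
    show "(\<lambda>v. A \<inter> ((T ^^ n) -` cylinder v \<inter> X)) ` words L m \<subseteq> events"
      using A vimage_funpow_sets(1)[OF sets_cylinder] by auto
    show "disjoint_family_on (\<lambda>v. A \<inter> ((T ^^ n) -` cylinder v \<inter> X)) (words L m)"
      by (auto simp: disjoint_family_on_def cylinder_def words_def)
  qed (rule finite_words)
  moreover have "(\<Union>v\<in>words L m. A \<inter> ((T ^^ n) -` cylinder v \<inter> X)) = A"
  proof -
    have "y \<in> (\<Union>v\<in>words L m. A \<inter> ((T ^^ n) -` cylinder v \<inter> X))" if "y \<in> A" for y
    proof -
      have y: "y \<in> X" using sets.sets_into_space[OF A] that by (auto simp: space)
      then have "(T ^^ n) y \<in> X" by (rule funpow_mem[OF T_into])
      then have "(T ^^ n) y \<in> cylinder (itinerary T a m ((T ^^ n) y))"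
        by (simp add: cylinder_def)
      then show ?thesis
        using itinerary_in_words[OF \<open>(T ^^ n) y \<in> X\<close>] y that by auto
    qed
    then show ?thesis by blast
  qed
  ultimately show ?thesis by simp
qed

lemma sum_prob_cylinder_eq_1: "(\<Sum>v\<in>words L m. prob (cylinder v)) = 1"
proof -
  have "X \<inter> ((T ^^ 0) -` cylinder v \<inter> X) = cylinder v" for v
    by (auto simp: cylinder_def)
  then show ?thesis
    using sum_prob_cylinder[OF sets.top, where m=m and n=0] prob_space by (simp add: space)
qed

text \<open>Gibbs' inequality for the joint law \<open>q\<close> of two adjacent blocks against the
  product \<open>s\<close> of their laws. That the second block is distributed like an initial one
  is the invariance of the measure.\<close>

lemma block_entropy_subadditive: "block_entropy (n + m) \<le> block_entropy n + block_entropy m"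
proof -
  define q where "q u v = prob (cylinder (u @ v))" for u v
  have left: "(\<Sum>v\<in>words L m. q u v) = prob (cylinder u)" if "u \<in> words L n" for u
    unfolding q_def cylinder_append using that
    by (intro sum_prob_cylinder sets_cylinder)
  have q_left: "q u v \<le> prob (cylinder u)" if "u \<in> words L n" for u v
    unfolding q_def cylinder_append by (rule finite_measure_mono) (use that in \<open>auto intro: sets_cylinder\<close>)
  have q_right: "q u v \<le> prob (cylinder v)" if "v \<in> words L m" for u v
  proof -
    have "q u v \<le> prob ((T ^^ length u) -` cylinder v \<inter> X)"
      unfolding q_def cylinder_append
      by (rule finite_measure_mono) (use vimage_funpow_sets(1)[OF sets_cylinder[OF that]] in auto)
    then show ?thesis
      by (simp add: vimage_funpow_sets(2)[OF sets_cylinder[OF that]])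
  qed
  have right: "(\<Sum>u\<in>words L n. q u v) = prob (cylinder v)" if v: "v \<in> words L m" for v
  proof -
    let ?A = "(T ^^ n) -` cylinder v \<inter> X"
    have "q u v = prob (?A \<inter> ((T ^^ 0) -` cylinder u \<inter> X))" if "u \<in> words L n" for u
      unfolding q_def cylinder_append using that
      by (intro arg_cong[where f=prob]) (auto simp: words_def cylinder_def)
    then show ?thesis
      using sum_prob_cylinder[OF vimage_funpow_sets(1)[OF sets_cylinder[OF v]], where m=n and n=0]
        vimage_funpow_sets(2)[OF sets_cylinder[OF v], of n] by simp
  qed
  define s where "s u v = prob (cylinder u) * prob (cylinder v)" for u v
  have pos: "0 < prob (cylinder u)" "0 < prob (cylinder v)"
    if "u \<in> words L n" "v \<in> words L m" "0 < q u v" for u v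
    using q_left[OF that(1), of v] q_right[OF that(2), of u] that(3) by linarith+
  let ?A = "words L n \<times> words L m"
  have "- (\<Sum>z\<in>?A. case_prod q z * ln (case_prod q z)) \<le> - (\<Sum>z\<in>?A. case_prod q z * ln (case_prod s z))"
  proof (rule cross_entropy_ge)
    have "(\<Sum>z\<in>?A. case_prod s z) = (\<Sum>u\<in>words L n. prob (cylinder u)) * (\<Sum>v\<in>words L m. prob (cylinder v))"
      by (simp add: sum_product sum.cartesian_product s_def split_def)
    moreover have "(\<Sum>z\<in>?A. case_prod q z) = (\<Sum>u\<in>words L n. \<Sum>v\<in>words L m. q u v)"
      by (simp add: sum.cartesian_product)
    ultimately show "(\<Sum>z\<in>?A. case_prod s z) \<le> (\<Sum>z\<in>?A. case_prod q z)"
      by (simp add: left sum_prob_cylinder_eq_1)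
  next
    fix z assume "z \<in> ?A" "0 < case_prod q z"
    then show "0 < case_prod s z"
      using pos[of "fst z" "snd z"] by (auto simp: s_def split_def)
  qed (auto simp: q_def s_def)
  also have "(\<Sum>z\<in>?A. case_prod q z * ln (case_prod s z))
      = (\<Sum>u\<in>words L n. \<Sum>v\<in>words L m. q u v * ln (s u v))"
    by (simp add: sum.cartesian_product split_def)
  also have "\<dots> = (\<Sum>u\<in>words L n. \<Sum>v\<in>words L m. q u v * ln (prob (cylinder u)) + q u v * ln (prob (cylinder v)))"
  proof (intro sum.cong refl)
    fix u v assume uv: "u \<in> words L n" "v \<in> words L m"
    show "q u v * ln (s u v) = q u v * ln (prob (cylinder u)) + q u v * ln (prob (cylinder v))"
    proof (cases "q u v = 0")
      case False
      then have "0 < q u v"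
        by (simp add: q_def zero_less_measure_iff)
      from pos[OF uv this] show ?thesis
        by (simp add: s_def ln_mult distrib_left)
    qed simp
  qed
  also have "\<dots> = (\<Sum>u\<in>words L n. \<Sum>v\<in>words L m. q u v * ln (prob (cylinder u)))
      + (\<Sum>v\<in>words L m. \<Sum>u\<in>words L n. q u v * ln (prob (cylinder v)))"
    using sum.swap[where A="words L n" and B="words L m" and g="\<lambda>u v. q u v * ln (prob (cylinder v))"]
    by (simp add: sum.distrib)
  also have "\<dots> = - block_entropy n - block_entropy m"
    by (simp add: sum_distrib_right[symmetric] left right block_entropy_def)
  finally have "- (\<Sum>z\<in>?A. case_prod q z * ln (case_prod q z)) \<le> block_entropy n + block_entropy m"
    by simp
  moreover have "block_entropy (n + m) = - (\<Sum>z\<in>?A. case_prod q z * ln (case_prod q z))"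
    by (simp add: block_entropy_def sum_words_append q_def sum.cartesian_product split_def)
  ultimately show ?thesis by simp
qed

lemma block_entropy_nonneg: "0 \<le> block_entropy n"
proof -
  have "prob (cylinder v) * ln (prob (cylinder v)) \<le> 0" for v
    by (cases "prob (cylinder v) = 0") (auto simp: zero_less_measure_iff mult_nonneg_nonpos)
  then show ?thesis
    by (simp add: block_entropy_def sum_nonpos)
qed

section \<open>From block entropies to the entropy of the map\<close>

definition code_partition :: "'a set set" where
  "code_partition = (\<lambda>i. {y\<in>X. a y = i}) ` {..<L}"

lemma meas_partition_code_partition: "meas_partition \<mu> code_partition"
  unfolding meas_partition_def code_partition_def
  using code_less code_jordan[THEN jordan_set_sets]
  by (auto simp: space disjoint_def)

lemma iter_join_code_partition: "iter_join (space \<mu>) T code_partition n = cylinder ` words L n"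
proof (intro equalityI subsetI)
  fix B assume "B \<in> iter_join (space \<mu>) T code_partition n"
  then obtain w where w: "w \<in> PiE {..<n} (\<lambda>_. code_partition)"
    and B: "B = {x\<in>X. \<forall>j<n. (T ^^ j) x \<in> w j}"
    by (auto simp: iter_join_def space)
  have "\<exists>i<L. w j = {y\<in>X. a y = i}" if "j < n" for j
    using PiE_mem[OF w, of j] that by (auto simp: code_partition_def)
  then obtain i where i: "\<And>j. j < n \<Longrightarrow> i j < L" "\<And>j. j < n \<Longrightarrow> w j = {y\<in>X. a y = i j}"
    by metis
  have "B = cylinder (map i [0..<n])"
    unfolding B cylinder_def using funpow_mem[OF T_into]
    by (auto simp: list_eq_iff_nth_eq itinerary_nth i)
  then show "B \<in> cylinder ` words L n"
    using i(1) by (intro image_eqI) (auto simp: words_def)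
next
  fix B assume "B \<in> cylinder ` words L n"
  then obtain v where v: "v \<in> words L n" "B = cylinder v"
    by auto
  define w where "w = restrict (\<lambda>j. {y\<in>X. a y = v ! j}) {..<n}"
  have "w \<in> PiE {..<n} (\<lambda>_. code_partition)"
    using v(1) by (auto simp: w_def code_partition_def words_def subset_iff)
  moreover have "B = {x\<in>X. \<forall>j<n. (T ^^ j) x \<in> w j}"
    using v funpow_mem[OF T_into]
    by (auto simp: cylinder_def list_eq_iff_nth_eq itinerary_nth w_def words_def)
  ultimately show "B \<in> iter_join (space \<mu>) T code_partition n"
    by (auto simp: iter_join_def space)
qed

lemma partition_entropy_code_partition:
  "partition_entropy \<mu> (iter_join (space \<mu>) T code_partition n) = block_entropy n"
proof -
  have "(\<Sum>B\<in>cylinder ` words L n. prob B * ln (prob B))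
      = (\<Sum>v\<in>words L n. prob (cylinder v) * ln (prob (cylinder v)))"
  \<comment> \<open>A partition is a set of sets, so words sharing a cylinder are counted once.
    Distinct words of equal length share only the empty cylinder, whose term is 0.\<close>
  proof (subst sum.reindex_nontrivial)
    fix u v assume "u \<in> words L n" "v \<in> words L n" "u \<noteq> v" "cylinder u = cylinder v"
    then have "cylinder u = {}"
      by (auto simp: cylinder_def words_def)
    then show "prob (cylinder u) * ln (prob (cylinder u)) = 0"
      by simp
  qed (simp_all add: finite_words)
  then show ?thesis
    by (simp add: partition_entropy_def iter_join_code_partition block_entropy_def)
qed

lemma block_entropy_less:
  assumes ks: "ks_entropy \<mu> T \<le> ereal t" and d: "0 < d"
  obtains m where "1 \<le> m" "block_entropy m < real m * (t + d)"
proof -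
  have "ereal (entropy_rel \<mu> T code_partition) \<le> ks_entropy \<mu> T"
    unfolding ks_entropy_def by (rule SUP_upper) (simp add: meas_partition_code_partition)
  then have "lim (\<lambda>n. block_entropy n / real n) \<le> t"
    using ks order_trans by (fastforce simp: entropy_rel_def partition_entropy_code_partition)
  moreover have "(\<lambda>n. block_entropy n / real n) \<longlonglongrightarrow> lim (\<lambda>n. block_entropy n / real n)"
    using fekete[of block_entropy] block_entropy_subadditive block_entropy_nonneg
    by (simp add: convergent_LIMSEQ_iff)
  ultimately have "\<forall>\<^sub>F n in sequentially. block_entropy n / real n < t + d"
    using d by (intro order_tendstoD) auto
  then have "\<forall>\<^sub>F n in sequentially. block_entropy n / real n < t + d \<and> 1 \<le> n"
    using eventually_ge_at_top by (rule eventually_conj)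
  then obtain m where "block_entropy m / real m < t + d" "1 \<le> m"
    by (auto simp: eventually_sequentially)
  then show ?thesis
    by (intro that[of m]) (auto simp: field_simps)
qed

end

text \<open>The rationality of the weights leaves only countably many of them, so that the set of points
  treated by the upper bound is a countable union.\<close>

lemma rational_weights:
  fixes p :: "'b \<Rightarrow> real"
  assumes A: "finite A" and p: "\<And>v. v \<in> A \<Longrightarrow> 0 \<le> p v" "(\<Sum>v\<in>A. p v) = 1" and e: "0 < e"
  obtains s where "s \<in> PiE A (\<lambda>_. \<rat> \<inter> {0<..})" "(\<Sum>v\<in>A. s v) \<le> 1"
    "- (\<Sum>v\<in>A. p v * ln (s v)) \<le> - (\<Sum>v\<in>A. p v * ln (p v)) + e"
proof -
  \<comment> \<open>Shrinking by \<open>c\<close> costs \<open>- ln c = e\<close> in the cross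
    entropy and frees the mass \<open>1 - c\<close>. Shared equally over \<open>A\<close>, this mass
    leaves room for rational weights above \<open>c * p v\<close>, positive even where
    \<open>p v = 0\<close>, with total at most 1.\<close>
  define c where "c = exp (- e)"
  have c: "0 < c" "c < 1" "ln c = - e"
    using e by (auto simp: c_def)
  have card: "0 < real (card A)"
    using A p(2) by (cases "A = {}") (auto simp: card_gt_0_iff)
  have "\<exists>r\<in>\<rat>. c * p v < r \<and> r < c * p v + (1 - c) / card A" for v
    by (rule Rats_dense_in_real) (use c card in auto)
  then obtain r where r: "\<And>v. r v \<in> \<rat>" "\<And>v. c * p v < r v" "\<And>v. r v < c * p v + (1 - c) / card A"
    by metis
  have r_pos: "0 < r v" if "v \<in> A" for v
    by (rule le_less_trans[OF mult_nonneg_nonneg[OF less_imp_le[OF c(1)] p(1)[OF that]] r(2)])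
  show ?thesis
  proof (rule that[of "restrict r A"])
    show "restrict r A \<in> PiE A (\<lambda>_. \<rat> \<inter> {0<..})"
      using r(1) r_pos by auto
    have "(\<Sum>v\<in>A. r v) \<le> (\<Sum>v\<in>A. c * p v + (1 - c) / card A)"
      by (intro sum_mono less_imp_le r)
    also have "\<dots> = 1"
      using card p(2) by (simp add: sum.distrib sum_distrib_left[symmetric])
    finally show "(\<Sum>v\<in>A. restrict r A v) \<le> 1"
      by simp
    have "p v * ln (p v) - p v * e \<le> p v * ln (r v)" if v: "v \<in> A" for v
    proof (cases "p v = 0")
      case False
      then have pos: "0 < p v"
        using p(1)[OF v] by simp
      then have "ln (c * p v) \<le> ln (r v)"
        using c r(2)[of v] r_pos[OF v] by (subst ln_le_cancel_iff) (auto intro: less_imp_le)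
      then have "ln (p v) - e \<le> ln (r v)"
        using c pos by (simp add: ln_mult)
      then have "p v * (ln (p v) - e) \<le> p v * ln (r v)"
        using pos by (intro mult_left_mono) auto
      then show ?thesis
        by (simp add: algebra_simps)
    qed simp
    then have "(\<Sum>v\<in>A. p v * ln (p v) - p v * e) \<le> (\<Sum>v\<in>A. p v * ln (r v))"
      by (rule sum_mono)
    then show "- (\<Sum>v\<in>A. p v * ln (restrict r A v)) \<le> - (\<Sum>v\<in>A. p v * ln (p v)) + e"
      using p(2) by (simp add: sum_subtractf sum_distrib_right[symmetric])
  qed
qed

context coded_weak_limit
begin

text \<open>On \<open>X\<close> the function \<open>- ln s\<close> of the current block is a linear
  combination of cylinder indicators. Cylinders are Jordan sets, so its orbit averages converge
  along \<open>G\<close> to the cross entropy of the block law and \<open>s\<close>.\<close>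

lemma itinerary_weights:
  assumes "G \<noteq> bot" and ks: "ks_entropy \<mu> T \<le> ereal t" and d: "0 < d"
  obtains m s where "1 \<le> m" "s \<in> PiE (words L m) (\<lambda>_. \<rat> \<inter> {0<..})" "(\<Sum>v\<in>words L m. s v) \<le> 1"
    "\<exists>\<^sub>F n in sequentially. (\<Sum>j<n. - ln (s (itinerary T a m ((T ^^ j) x)))) < real n * (real m * (t + d))"
proof -
  obtain m where m: "1 \<le> m" "block_entropy m < real m * (t + d)"
    using block_entropy_less[OF ks d] .
  define e where "e = (real m * (t + d) - block_entropy m) / 2"
  have e: "0 < e" using m by (simp add: e_def)
  obtain s where s: "s \<in> PiE (words L m) (\<lambda>_. \<rat> \<inter> {0<..})" "(\<Sum>v\<in>words L m. s v) \<le> 1"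
    "- (\<Sum>v\<in>words L m. prob (cylinder v) * ln (s v)) \<le> block_entropy m + e"
    using rational_weights[OF finite_words measure_nonneg sum_prob_cylinder_eq_1 e] unfolding block_entropy_def .
  let ?\<phi> = "\<lambda>y. - ln (s (itinerary T a m y))"
  have \<phi>: "?\<phi> y = (\<Sum>v\<in>words L m. - ln (s v) * indicator (cylinder v) y)" if "y \<in> X" for y
  proof -
    have "(\<Sum>v\<in>words L m. - ln (s v) * indicator (cylinder v) y)
        = (\<Sum>v\<in>words L m. if v = itinerary T a m y then - ln (s v) else 0)"
      by (rule sum.cong) (use that in \<open>auto simp: cylinder_def words_def indicator_def\<close>)
    then show ?thesis
      using itinerary_in_words[OF that, of m] by (simp add: finite_words)
  qed
  have "birkhoff_mean T x ?\<phi> n = (\<Sum>v\<in>words L m. - ln (s v) * birkhoff_mean T x (indicator (cylinder v)) n)" for n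
  proof -
    have "(\<Sum>j<n. ?\<phi> ((T ^^ j) x)) = (\<Sum>j<n. \<Sum>v\<in>words L m. - ln (s v) * indicator (cylinder v) ((T ^^ j) x))"
      by (intro sum.cong refl \<phi> funpow_mem[OF T_into x])
    also have "\<dots> = (\<Sum>v\<in>words L m. - ln (s v) * (\<Sum>j<n. indicator (cylinder v) ((T ^^ j) x)))"
      by (subst sum.swap) (simp add: sum_distrib_left)
    finally show ?thesis
      by (simp add: sum_divide_distrib[where A="words L m"])
  qed
  moreover have "((\<lambda>n. \<Sum>v\<in>words L m. - ln (s v) * birkhoff_mean T x (indicator (cylinder v)) n)
      \<longlongrightarrow> (\<Sum>v\<in>words L m. - ln (s v) * prob (cylinder v))) G"
    by (intro tendsto_sum tendsto_mult_left frequency_tendsto jordan_cylinder) (simp add: words_def)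
  moreover have "(\<Sum>v\<in>words L m. - ln (s v) * prob (cylinder v)) < real m * (t + d)"
    using s(3) e m by (simp add: e_def sum_negf mult.commute field_simps)
  ultimately have "\<forall>\<^sub>F n in G. birkhoff_mean T x ?\<phi> n < real m * (t + d)"
    by (simp only: order_tendstoD(2))
  moreover have "\<forall>\<^sub>F n in G. 1 \<le> n"
    using filter_leD[OF G eventually_ge_at_top] .
  ultimately have "\<forall>\<^sub>F n in G. (\<Sum>j<n. ?\<phi> ((T ^^ j) x)) < real n * (real m * (t + d))"
    by eventually_elim (simp add: field_simps)
  \<comment> \<open>What holds eventually along a nontrivial filter finer than
    \<open>sequentially\<close> holds infinitely often.\<close>
  then have "\<exists>\<^sub>F n in sequentially. (\<Sum>j<n. ?\<phi> ((T ^^ j) x)) < real n * (real m * (t + d))"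
    using eventually_frequently[OF assms(1)] filter_leD[OF G] unfolding frequently_def by blast
  then show ?thesis
    using that m(1) s by blast
qed

end

text \<open>The spheres around a fixed centre are disjoint, so all but countably many radii give null
  spheres. The radius depends on \<open>\<mu>\<close>, but the alphabet (the centres) does not.\<close>

lemma (in weak_limit) ex_coding:
  assumes e: "0 < e" and cover: "X \<subseteq> (\<Union>i<L. ball (c i) (e / 2))"
  obtains a where "coded_weak_limit X T x G \<mu> a L" "\<And>y. y \<in> X \<Longrightarrow> dist (c (a y)) y < e"
proof -
  have "countable (\<Union>i<L. {s. measure \<mu> {y\<in>X. dist (c i) y = s} \<noteq> 0})"
  proof (rule countable_UN)
    fix i
    have d: "(\<lambda>y. dist (c i) y) \<in> borel_measurable \<mu>"
      by (rule continuous_measurable) (intro continuous_intros)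
    interpret D: prob_space "distr \<mu> borel (\<lambda>y. dist (c i) y)"
      by (rule prob_space_distr[OF d])
    have "measure (distr \<mu> borel (\<lambda>y. dist (c i) y)) {s} = measure \<mu> {y\<in>X. dist (c i) y = s}" for s
      using measure_distr[OF d, of "{s}"] by (simp add: space vimage_def Int_def conj_commute)
    then show "countable {s. measure \<mu> {y\<in>X. dist (c i) y = s} \<noteq> 0}"
      using D.countable_support by simp
  qed auto
  \<comment> \<open>Radii above \<open>e / 2\<close> keep the balls covering \<open>X\<close>; radii
    below \<open>e\<close> keep each point within \<open>e\<close> of its centre.\<close>
  moreover have "uncountable {e / 2<..<e}"
    using e by (simp add: uncountable_open_interval)
  ultimately have "\<not> {e / 2<..<e} \<subseteq> (\<Union>i<L. {s. measure \<mu> {y\<in>X. dist (c i) y = s} \<noteq> 0})"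
    using countable_subset by blast
  then obtain s where s: "e / 2 < s" "s < e"
    and null: "\<And>i. i < L \<Longrightarrow> measure \<mu> {y\<in>X. dist (c i) y = s} = 0"
    by (auto simp: subset_iff)
  define a where "a y = (LEAST i. dist (c i) y < s)" for y
  have ex: "\<exists>i<L. dist (c i) y < s" if "y \<in> X" for y
  proof -
    obtain i where "i < L" "dist (c i) y < e / 2"
      using cover \<open>y \<in> X\<close> by auto
    then show ?thesis
      using s by (intro exI[of _ i]) simp
  qed
  have a: "a y < L" "dist (c (a y)) y < s" if "y \<in> X" for y
  proof -
    obtain i where i: "i < L" "dist (c i) y < s"
      using ex[OF \<open>y \<in> X\<close>] by blast
    show "dist (c (a y)) y < s"
      unfolding a_def by (rule LeastI[of "\<lambda>i. dist (c i) y < s", OF i(2)])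
    show "a y < L"
      unfolding a_def using Least_le[of "\<lambda>i. dist (c i) y < s", OF i(2)] i(1) by simp
  qed
  have first: "jordan_set (X - {y\<in>X. \<exists>j<i. dist (c j) y < s})" if "i \<le> L" for i
    using that
  proof (induction i)
    case 0
    then show ?case by (simp add: jordan_set_space)
  next
    case (Suc i)
    have "X - {y\<in>X. \<exists>j<Suc i. dist (c j) y < s}
        = (X - {y\<in>X. \<exists>j<i. dist (c j) y < s}) \<inter> (X - {y\<in>X. dist (c i) y < s})"
      by (auto simp: less_Suc_eq)
    then show ?case
      using Suc by (simp add: jordan_set_Int jordan_set_Diff jordan_set_ball null)
  qed
  have "jordan_set {y\<in>X. a y = i}" if "i < L" for i
  proof -
    have "{y\<in>X. a y = i} = {y\<in>X. dist (c i) y < s} \<inter> (X - {y\<in>X. \<exists>j<i. dist (c j) y < s})"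
    proof -
      have "a y = i \<longleftrightarrow> dist (c i) y < s \<and> \<not> (\<exists>j<i. dist (c j) y < s)" if "y \<in> X" for y
      proof
        assume "a y = i"
        then show "dist (c i) y < s \<and> \<not> (\<exists>j<i. dist (c j) y < s)"
          using a(2)[OF that] not_less_Least[of _ "\<lambda>i. dist (c i) y < s"] unfolding a_def by blast
      next
        assume "dist (c i) y < s \<and> \<not> (\<exists>j<i. dist (c j) y < s)"
        then show "a y = i"
          unfolding a_def by (intro Least_equality) (auto intro: leI)
      qed
      then show ?thesis by blast
    qed
    then show ?thesis
      using first[of i] null that by (simp add: jordan_set_Int jordan_set_ball)
  qed
  then have "coded_weak_limit X T x G \<mu> a L"
    by unfold_locales (use a in auto)
  then show ?thesis
  proof (rule that)
    show "dist (c (a y)) y < e" if "y \<in> X" for y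
      using a(2)[OF that] s(2) by simp
  qed
qed

section \<open>Bowen's topological entropy\<close>

lemma bowen_H_n_mono: "Z \<subseteq> Z' \<Longrightarrow> bowen_H_n X T s n Z \<epsilon> \<le> bowen_H_n X T s n Z' \<epsilon>"
  unfolding bowen_H_n_def by (rule INF_superset_mono) auto

lemma htop_mono: "Z \<subseteq> Z' \<Longrightarrow> htop X T Z \<le> htop X T Z'"
  unfolding htop_def
proof (rule SUP_mono', goal_cases)
  case (1 \<epsilon>)
  then have "bowen_H X T s Z \<epsilon> \<le> bowen_H X T s Z' \<epsilon>" for s
    unfolding bowen_H_def by (intro SUP_mono' bowen_H_n_mono)
  then have "bowen_H X T s Z \<epsilon> = 0" if "bowen_H X T s Z' \<epsilon> = 0" for s
    using that by (metis le_zero_eq)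
  then show ?case
    unfolding htop_eps_def by (intro Inf_superset_mono image_mono) auto
qed

text \<open>\<open>bowen_H_n\<close> admits covers indexed by subsets of \<open>nat\<close>; the
  pairing bijection merges a sequence of covers into one.\<close>

lemma bowen_H_n_le_double:
  assumes z: "\<And>k i. i \<in> I k \<Longrightarrow> z k i \<in> X \<and> n \<le> N k i"
    and cover: "Z \<subseteq> (\<Union>k. \<Union>i\<in>I k. bowen_ball X T (z k i) (N k i) \<epsilon>)"
  shows "bowen_H_n X T s n Z \<epsilon> \<le> (\<Sum>k. \<Sum>i. if i \<in> I k then ennreal (exp (- s * real (N k i))) else 0)"
proof -
  define J where "J = {l. snd (prod_decode l) \<in> I (fst (prod_decode l))}"
  define c where "c l = case_prod z (prod_decode l)" for l
  define M where "M l = case_prod N (prod_decode l)" for l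
  have "bowen_H_n X T s n Z \<epsilon> \<le> (\<Sum>l. if l \<in> J then ennreal (exp (- s * real (M l))) else 0)"
    unfolding bowen_H_n_def
  proof (rule INF_lower2[of "(J, c, M)"])
    have "Z \<subseteq> (\<Union>l\<in>J. bowen_ball X T (c l) (M l) \<epsilon>)"
    proof
      fix x assume "x \<in> Z"
      then obtain k i where ki: "i \<in> I k" "x \<in> bowen_ball X T (z k i) (N k i) \<epsilon>"
        using cover by blast
      then show "x \<in> (\<Union>l\<in>J. bowen_ball X T (c l) (M l) \<epsilon>)"
        by (intro UN_I[of "prod_encode (k, i)"]) (auto simp: J_def c_def M_def)
    qed
    then show "(J, c, M) \<in> {(I, c, m). (\<forall>i\<in>I. c i \<in> X \<and> n \<le> m i) \<and> Z \<subseteq> (\<Union>i\<in>I. bowen_ball X T (c i) (m i) \<epsilon>)}"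
      using z by (auto simp: J_def c_def M_def split_def)
  qed simp
  also have "\<dots> = (\<Sum>l. (\<lambda>(k, i). if i \<in> I k then ennreal (exp (- s * real (N k i))) else 0) (prod_decode l))"
    by (intro suminf_cong) (simp add: J_def M_def split_def)
  also have "\<dots> = (\<Sum>k. \<Sum>i. if i \<in> I k then ennreal (exp (- s * real (N k i))) else 0)"
    by (rule suminf_ennreal_2dimen) simp
  finally show ?thesis .
qed

text \<open>The union of covers of costs at most \<open>e / 2 ^ (k + 1)\<close> has cost at most
  \<open>e\<close>.\<close>

lemma bowen_H_n_countable_UN:
  assumes K: "countable K" and zero: "\<And>k. k \<in> K \<Longrightarrow> bowen_H_n X T s n (Z k) \<epsilon> = 0"
  shows "bowen_H_n X T s n (\<Union>k\<in>K. Z k) \<epsilon> = 0"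
proof -
  have "bowen_H_n X T s n (\<Union>k\<in>K. Z k) \<epsilon> \<le> 0"
  proof (rule ennreal_le_epsilon)
    fix e :: real assume e: "0 < e"
    \<comment> \<open>\<open>K\<close> may be finite, so some \<open>k\<close> enumerate no set; for
      these the covering clause is vacuous and the empty family is chosen.\<close>
    define good where "good k I c M \<longleftrightarrow> (\<forall>i\<in>I. c i \<in> X \<and> n \<le> M i) \<and>
        (\<forall>l\<in>K. to_nat_on K l = k \<longrightarrow> Z l \<subseteq> (\<Union>i\<in>I. bowen_ball X T (c i) (M i) \<epsilon>)) \<and>
        (\<Sum>i. if i \<in> I then ennreal (exp (- s * real (M i))) else 0) \<le> ennreal (e * (1/2)^Suc k)"
      for k and I :: "nat set" and c M
    have "\<exists>I c M. good k I c M" for k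
    proof (cases "\<exists>l\<in>K. to_nat_on K l = k")
      case False
      then show ?thesis
        by (intro exI[of _ "{}"]) (auto simp: good_def)
    next
      case True
      then obtain l where l: "l \<in> K" "to_nat_on K l = k" by blast
      have "bowen_H_n X T s n (Z l) \<epsilon> < ennreal (e * (1/2)^Suc k)"
        using zero[OF l(1)] e by simp
      then obtain I c M where "\<forall>i\<in>I. c i \<in> X \<and> n \<le> M i" "Z l \<subseteq> (\<Union>i\<in>I. bowen_ball X T (c i) (M i) \<epsilon>)"
        "(\<Sum>i. if i \<in> I then ennreal (exp (- s * real (M i))) else 0) < ennreal (e * (1/2)^Suc k)"
        unfolding bowen_H_n_def INF_less_iff by auto
      moreover have "l' = l" if "l' \<in> K" "to_nat_on K l' = k" for l'
        using inj_onD[OF inj_on_to_nat_on[OF K], of l' l] that l by simp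
      ultimately show ?thesis
        by (intro exI[of _ I] exI[of _ c] exI[of _ M]) (auto simp: good_def intro: less_imp_le)
    qed
    then obtain I c M where good: "\<And>k. good k (I k) (c k) (M k)"
      by metis
    have I: "\<And>k i. i \<in> I k \<Longrightarrow> c k i \<in> X \<and> n \<le> M k i"
      "\<And>l. l \<in> K \<Longrightarrow> Z l \<subseteq> (\<Union>i\<in>I (to_nat_on K l). bowen_ball X T (c (to_nat_on K l) i) (M (to_nat_on K l) i) \<epsilon>)"
      "\<And>k. (\<Sum>i. if i \<in> I k then ennreal (exp (- s * real (M k i))) else 0) \<le> ennreal (e * (1/2)^Suc k)"
      using good unfolding good_def by blast+
    have "bowen_H_n X T s n (\<Union>k\<in>K. Z k) \<epsilon> \<le> (\<Sum>k. \<Sum>i. if i \<in> I k then ennreal (exp (- s * real (M k i))) else 0)"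
      by (rule bowen_H_n_le_double[OF I(1)]) (use I(2) in blast)+
    also have "\<dots> \<le> (\<Sum>k. ennreal (e * (1/2)^Suc k))"
      by (intro suminf_le I(3)) auto
    also have "\<dots> = ennreal e"
      using sums_mult[OF power_half_series, of e] e by (intro suminf_ennreal_eq) auto
    finally show "bowen_H_n X T s n (\<Union>k\<in>K. Z k) \<epsilon> \<le> 0 + ennreal e"
      by simp
  qed
  then show ?thesis by simp
qed

text \<open>A Borel-Cantelli argument: points caught infinitely often are covered by the balls of
  all lengths from \<open>N'\<close> on, whose total cost is a geometric tail of ratio
  \<open>exp (\<sigma> - s)\<close>.\<close>

lemma bowen_H_n_eq_0:
  assumes W: "\<And>n. finite (W n)" "\<And>n. real (card (W n)) \<le> C * exp (real n * \<sigma>)"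
    and z: "\<And>n w. w \<in> W n \<Longrightarrow> z n w \<in> X"
    and cover: "\<And>x. x \<in> Z \<Longrightarrow> \<exists>\<^sub>F n in sequentially. \<exists>w\<in>W n. x \<in> bowen_ball X T (z n w) n \<epsilon>"
    and s: "\<sigma> < s"
  shows "bowen_H_n X T s N Z \<epsilon> = 0"
proof -
  define q where "q = exp (\<sigma> - s)"
  have q: "0 < q" "q < 1" using s by (auto simp: q_def)
  have C: "0 \<le> C" using order_trans[OF _ W(2)[of 0]] by simp
  have "bowen_H_n X T s N Z \<epsilon> \<le> 0"
  proof (rule ennreal_le_epsilon)
    fix e :: real assume e: "0 < e"
    have "(\<lambda>k. C * q ^ k / (1 - q)) \<longlonglongrightarrow> C * 0 / (1 - q)"
      using q by (intro tendsto_intros LIMSEQ_power_zero) auto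
    then have "\<forall>\<^sub>F k in sequentially. C * q ^ k / (1 - q) < e \<and> N \<le> k"
      using e by (intro eventually_conj eventually_ge_at_top order_tendstoD) auto
    then obtain N' where N': "C * q ^ N' / (1 - q) < e" "N \<le> N'"
      by (auto simp: eventually_sequentially)
    obtain h where h: "\<And>n. bij_betw (h n) {0..<card (W n)} (W n)"
      using ex_bij_betw_nat_finite[OF W(1)] by metis
    let ?I = "\<lambda>k. {..<card (W (N' + k))}"
    have "bowen_H_n X T s N Z \<epsilon> \<le> (\<Sum>k. \<Sum>i. if i \<in> ?I k then ennreal (exp (- s * real (N' + k))) else 0)"
    proof (rule bowen_H_n_le_double)
      show "z (N' + k) (h (N' + k) i) \<in> X \<and> N \<le> N' + k" if "i \<in> ?I k" for k i
        using bij_betwE[OF h[of "N' + k"]] that N'(2) by (auto intro!: z)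
      show "Z \<subseteq> (\<Union>k. \<Union>i\<in>?I k. bowen_ball X T (z (N' + k) (h (N' + k) i)) (N' + k) \<epsilon>)"
      proof
        fix x assume "x \<in> Z"
        then obtain n w where n: "N' \<le> n" "w \<in> W n" "x \<in> bowen_ball X T (z n w) n \<epsilon>"
          using cover[OF \<open>x \<in> Z\<close>] unfolding frequently_sequentially by blast
        moreover have "w \<in> h n ` {0..<card (W n)}"
          using n(2) bij_betw_imp_surj_on[OF h[of n]] by simp
        then obtain i where "i < card (W n)" "w = h n i"
          by auto
        ultimately show "x \<in> (\<Union>k. \<Union>i\<in>?I k. bowen_ball X T (z (N' + k) (h (N' + k) i)) (N' + k) \<epsilon>)"
          using n by (intro UN_I[of "n - N'"] UN_I[of i]) auto
      qed
    qed
    also have "\<dots> \<le> (\<Sum>k. ennreal (C * q ^ N' * q ^ k))"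
    proof (intro suminf_le summableI)
      fix k
      have "(\<Sum>i. if i \<in> ?I k then ennreal (exp (- s * real (N' + k))) else 0)
          = (\<Sum>i\<in>?I k. ennreal (exp (- s * real (N' + k))))"
        by (subst suminf_finite[of "?I k"]) auto
      also have "\<dots> = ennreal (real (card (W (N' + k))) * exp (- s * real (N' + k)))"
        by (simp add: ennreal_of_nat_eq_real_of_nat ennreal_mult)
      also have "\<dots> \<le> ennreal (C * exp (real (N' + k) * \<sigma>) * exp (- s * real (N' + k)))"
        by (intro ennreal_leI mult_right_mono W(2)) simp
      also have "C * exp (real (N' + k) * \<sigma>) * exp (- s * real (N' + k)) = C * q ^ N' * q ^ k"
        by (simp add: q_def exp_of_nat_mult[symmetric] exp_add[symmetric] algebra_simps)
      finally show "(\<Sum>i. if i \<in> ?I k then ennreal (exp (- s * real (N' + k))) else 0) \<le> ennreal (C * q ^ N' * q ^ k)" .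
    qed
    also have "\<dots> = ennreal (C * q ^ N' * (1 / (1 - q)))"
      using q C by (intro suminf_ennreal_eq sums_mult geometric_sums) auto
    also have "\<dots> \<le> 0 + ennreal e"
      using N'(1) by (simp add: ennreal_leI less_imp_le)
    finally show "bowen_H_n X T s N Z \<epsilon> \<le> 0 + ennreal e" .
  qed
  then show ?thesis by simp
qed

section \<open>Counting itineraries\<close>

text \<open>The sum factors over the \<open>K\<close> blocks, each factor being at most 1; the last
  \<open>e\<close> letters are unweighted and contribute the number of their choices.\<close>

lemma sum_words_block_weights:
  assumes s: "\<And>v. v \<in> words L m \<Longrightarrow> 0 \<le> s v" "(\<Sum>v\<in>words L m. s v) \<le> (1 :: real)"
  shows "(\<Sum>w\<in>words L (K * m + e). \<Prod>k<K. s (take m (drop (k * m) w))) \<le> real L ^ e"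
proof (induction K)
  case 0
  then show ?case by (simp add: card_words)
next
  case (Suc K)
  have nn: "0 \<le> (\<Prod>k<K. s (take m (drop (k * m) v)))" if "v \<in> words L (K * m + e)" for v
  proof (rule prod_nonneg)
    fix k assume "k \<in> {..<K}"
    then have "Suc k * m \<le> K * m" by (intro mult_right_mono) auto
    then have "take m (drop (k * m) v) \<in> words L m"
      using that by (auto simp: words_def dest: in_set_takeD in_set_dropD)
    then show "0 \<le> s (take m (drop (k * m) v))" by (rule s)
  qed
  have "(\<Sum>w\<in>words L (Suc K * m + e). \<Prod>k<Suc K. s (take m (drop (k * m) w)))
      = (\<Sum>u\<in>words L m. \<Sum>v\<in>words L (K * m + e). \<Prod>k<Suc K. s (take m (drop (k * m) (u @ v))))"
    unfolding mult_Suc add.assoc by (rule sum_words_append)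
  also have "\<dots> = (\<Sum>u\<in>words L m. \<Sum>v\<in>words L (K * m + e). s u * (\<Prod>k<K. s (take m (drop (k * m) v))))"
    by (intro sum.cong refl, subst prod.lessThan_Suc_shift) (simp add: words_def)
  also have "\<dots> = (\<Sum>u\<in>words L m. s u) * (\<Sum>v\<in>words L (K * m + e). \<Prod>k<K. s (take m (drop (k * m) v)))"
    by (simp add: sum_product)
  also have "\<dots> \<le> 1 * (\<Sum>v\<in>words L (K * m + e). \<Prod>k<K. s (take m (drop (k * m) v)))"
    by (intro mult_right_mono s sum_nonneg nn)
  also have "\<dots> \<le> real L ^ e"
    using Suc by simp
  finally show ?case .
qed

text \<open>Markov's inequality for the product weights \<open>s\<close> on consecutive blocks of length \<open>m\<close>.\<close>

lemma card_words_block_weights: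
  assumes s: "\<And>v. v \<in> words L m \<Longrightarrow> 0 < s v" "(\<Sum>v\<in>words L m. s v) \<le> (1 :: real)"
  shows "real (card {w \<in> words L (p + (K * m + e)). (\<Sum>k<K. - ln (s (take m (drop (p + k * m) w)))) < b})
    \<le> real L ^ (p + e) * exp b"
proof -
  let ?S = "{w \<in> words L (p + (K * m + e)). (\<Sum>k<K. - ln (s (take m (drop (p + k * m) w)))) < b}"
  let ?W = "\<lambda>w. \<Prod>k<K. s (take m (drop (p + k * m) w))"
  have pos: "0 < s (take m (drop (p + k * m) w))" if "w \<in> words L (p + (K * m + e))" "k < K" for w k
  proof -
    have "Suc k * m \<le> K * m" using that by (intro mult_right_mono) auto
    then have "take m (drop (p + k * m) w) \<in> words L m"
      using that by (auto simp: words_def dest: in_set_takeD in_set_dropD)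
    then show ?thesis by (rule s)
  qed
  have "real (card ?S) = (\<Sum>w\<in>?S. 1)" by simp
  also have "\<dots> \<le> (\<Sum>w\<in>?S. ?W w * exp b)"
  proof (rule sum_mono)
    fix w assume w: "w \<in> ?S"
    then have "?W w = exp (\<Sum>k<K. ln (s (take m (drop (p + k * m) w))))"
      by (subst exp_sum) (auto intro!: prod.cong simp: pos)
    then have "?W w * exp b = exp (b - (\<Sum>k<K. - ln (s (take m (drop (p + k * m) w)))))"
      by (simp add: exp_add[symmetric] sum_negf add.commute)
    also have "\<dots> \<ge> 1"
      using w by simp
    finally show "1 \<le> ?W w * exp b" .
  qed
  also have "\<dots> \<le> (\<Sum>w\<in>words L (p + (K * m + e)). ?W w * exp b)"
    by (intro sum_mono2 finite_words) (auto intro!: prod_nonneg mult_nonneg_nonneg less_imp_le[OF pos])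
  also have "\<dots> = (\<Sum>w\<in>words L (p + (K * m + e)). ?W w) * exp b"
    by (simp add: sum_distrib_right)
  \<comment> \<open>The weights do not see the first \<open>p\<close> letters, which only contribute
    their number \<open>L ^ p\<close>.\<close>
  also have "(\<Sum>w\<in>words L (p + (K * m + e)). ?W w)
      = (\<Sum>u\<in>words L p. \<Sum>v\<in>words L (K * m + e). \<Prod>k<K. s (take m (drop (k * m) v)))"
    unfolding sum_words_append by (intro sum.cong prod.cong refl) (simp add: words_def)
  also have "\<dots> = real L ^ p * (\<Sum>v\<in>words L (K * m + e). \<Prod>k<K. s (take m (drop (k * m) v)))"
    by (simp add: card_words)
  also have "\<dots> * exp b \<le> real L ^ p * real L ^ e * exp b"
    by (intro mult_right_mono mult_left_mono sum_words_block_weights less_imp_le[OF s(1)] s(2)) auto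
  finally show ?thesis
    by (simp add: power_add)
qed

text \<open>The sum over all positions is distributed over the residue classes modulo \<open>m\<close>; one of them
  carries at most its share. This passes from overlapping to consecutive blocks.\<close>

lemma ex_residue_class:
  fixes f :: "nat \<Rightarrow> real"
  assumes nn: "\<And>j. 0 \<le> f j" and sum: "(\<Sum>j<n. f j) < real n * (real m * b)" and m: "1 \<le> m"
  shows "\<exists>p<m. (\<Sum>k<n div m. f (p + k * m)) < real n * b"
proof (rule ccontr)
  assume "\<not> ?thesis"
  then have "real n * b \<le> (\<Sum>k<n div m. f (p + k * m))" if "p < m" for p
    using that by (metis not_less)
  then have "(\<Sum>p<m. real n * b) \<le> (\<Sum>p<m. \<Sum>k<n div m. f (p + k * m))"
    by (intro sum_mono) auto
  also have "\<dots> = (\<Sum>(p,k)\<in>{..<m} \<times> {..<n div m}. f (p + k * m))"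
    by (simp add: sum.cartesian_product)
  also have "\<dots> = (\<Sum>j\<in>(\<lambda>(p,k). p + k * m) ` ({..<m} \<times> {..<n div m}). f j)"
  proof (subst sum.reindex)
    show "inj_on (\<lambda>(p,k). p + k * m) ({..<m} \<times> {..<n div m})"
    proof (rule inj_onI)
      fix y z assume mem: "y \<in> {..<m} \<times> {..<n div m}" "z \<in> {..<m} \<times> {..<n div m}"
        and *: "(case y of (p, k) \<Rightarrow> p + k * m) = (case z of (p, k) \<Rightarrow> p + k * m)"
      from mem have "fst y = (case y of (p, k) \<Rightarrow> p + k * m) mod m" "fst z = (case z of (p, k) \<Rightarrow> p + k * m) mod m"
        by auto
      then have "fst y = fst z"
        unfolding * by (rule trans[OF _ sym])
      then show "y = z"
        using * m by (simp add: split_def prod_eq_iff)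
    qed
  qed (simp add: split_def)
  also have "\<dots> \<le> (\<Sum>j<n. f j)"
  proof (rule sum_mono2)
    show "(\<lambda>(p,k). p + k * m) ` ({..<m} \<times> {..<n div m}) \<subseteq> {..<n}"
    proof
      fix j assume "j \<in> (\<lambda>(p,k). p + k * m) ` ({..<m} \<times> {..<n div m})"
      then obtain p k where j: "j = p + k * m" "p < m" "k < n div m"
        by auto
      then have "p + k * m < Suc k * m" "Suc k * m \<le> (n div m) * m"
        using mult_le_mono1[of "Suc k" "n div m" m] by auto
      then have "p + k * m < (n div m) * m"
        by linarith
      then show "j \<in> {..<n}"
        unfolding j lessThan_iff
        using less_le_trans[OF _ div_times_less_eq_dividend[of n m]] by blast
    qed
  qed (use nn in auto)
  finally show False
    using sum by (simp add: algebra_simps)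
qed

section \<open>The upper bound\<close>

text \<open>The coding \<open>a\<close> may depend on the point; only the centres \<open>c\<close>, the block length \<open>m\<close> and the weights \<open>s\<close>
  are fixed.\<close>

definition weighted_set ::
  "'a::metric_space set \<Rightarrow> ('a \<Rightarrow> 'a) \<Rightarrow> (nat \<Rightarrow> 'a) \<Rightarrow> nat \<Rightarrow> real \<Rightarrow> real \<Rightarrow> nat \<Rightarrow> (nat list \<Rightarrow> real) \<Rightarrow> 'a set" where
  "weighted_set X T c L e b m s = {x\<in>X. \<exists>a. (\<forall>y\<in>X. a y < L \<and> dist (c (a y)) y < e) \<and>
     (\<exists>\<^sub>F n in sequentially. (\<Sum>j<n. - ln (s (itinerary T a m ((T ^^ j) x)))) < real n * (real m * b))}"

lemma take_drop_itinerary: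
  "j + m \<le> n \<Longrightarrow> take m (drop j (itinerary T a n y)) = itinerary T a m ((T ^^ j) y)"
  by (rule nth_equalityI) (auto simp: itinerary_nth funpow_add add.commute)

text \<open>At infinitely many \<open>n\<close> the word of the orbit is light along some residue
  class \<open>p\<close>, and light words number at most a constant times
  \<open>exp (n * b)\<close>. One Bowen ball per word suffices, centred at any point following the
  same centres.\<close>

lemma bowen_H_n_weighted_set:
  assumes T: "T ` X \<subseteq> X" and m: "1 \<le> m"
    and s: "\<And>v. v \<in> words L m \<Longrightarrow> 0 < s v" "(\<Sum>v\<in>words L m. s v) \<le> 1" and b: "b < t"
  shows "bowen_H_n X T t N (weighted_set X T c L (e / 2) b m s) e = 0"
proof -
  \<comment> \<open>Blocks start at \<open>p + k * m\<close> with \<open>p < m\<close> and may run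
    past time \<open>n\<close>, so words have length \<open>n + m\<close>; the last summand is the
    unweighted tail.\<close>
  define S where "S n p = {w \<in> words L (p + ((n div m) * m + (n + m - (n div m) * m - p))).
      (\<Sum>k<n div m. - ln (s (take m (drop (p + k * m) w)))) < real n * b}" for n p
  \<comment> \<open>No labelling occurs here: points following the same word stay within
    \<open>e\<close> of each other for \<open>n\<close> steps even if their labellings
    differ.\<close>
  define P where "P n w z \<longleftrightarrow> z \<in> X \<and> (\<forall>j<n. dist (c (w ! j)) ((T ^^ j) z) < e / 2)" for n w z
  define W where "W n = {w \<in> (\<Union>p<m. S n p). \<exists>z. P n w z}" for n
  define z where "z n w = (SOME z. P n w z)" for n w
  have z: "P n w (z n w)" if "w \<in> W n" for n w
    using that unfolding W_def z_def by (auto intro: someI_ex)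
  have fin: "finite (S n p)" for n p
    unfolding S_def using finite_words by simp
  \<comment> \<open>This makes the terms \<open>- ln (s v)\<close> nonnegative, as the choice of a
    residue class requires.\<close>
  have s_le: "s v \<le> 1" if "v \<in> words L m" for v
    by (rule order_trans[OF member_le_sum s(2)]) (use that s(1) finite_words in \<open>auto intro: less_imp_le\<close>)
  show ?thesis
  \<comment> \<open>The constant accounts for the \<open>m\<close> residue classes and at most
    \<open>2 * m\<close> unweighted letters; \<open>Suc L\<close> keeps the base at least 1 when
    \<open>L = 0\<close>.\<close>
  proof (rule bowen_H_n_eq_0[where W=W and C="real m * real (Suc L) ^ (2 * m)" and z=z])
    show "finite (W n)" for n
      unfolding W_def using fin by auto
    show "real (card (W n)) \<le> real m * real (Suc L) ^ (2 * m) * exp (real n * b)" for n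
    proof -
      have "card (W n) \<le> card (\<Union>p<m. S n p)"
        unfolding W_def using fin by (intro card_mono) auto
      also have "\<dots> \<le> (\<Sum>p<m. card (S n p))"
        by (rule card_UN_le) simp
      finally have "real (card (W n)) \<le> (\<Sum>p<m. real (card (S n p)))"
        by (simp flip: of_nat_sum)
      also have "\<dots> \<le> (\<Sum>p<m. real (Suc L) ^ (2 * m) * exp (real n * b))"
      proof (rule sum_mono)
        fix p assume "p \<in> {..<m}"
        then have p: "p + (n + m - (n div m) * m - p) \<le> 2 * m"
        proof -
          have "n mod m < m" using m by simp
          moreover have "(n div m) * m + n mod m = n" by (rule div_mult_mod_eq)
          ultimately show ?thesis using \<open>p \<in> {..<m}\<close> unfolding lessThan_iff by linarith
        qed
        have "real (card (S n p)) \<le> real L ^ (p + (n + m - (n div m) * m - p)) * exp (real n * b)"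
          unfolding S_def by (rule card_words_block_weights[OF s])
        also have "real L ^ (p + (n + m - (n div m) * m - p)) \<le> real (Suc L) ^ (p + (n + m - (n div m) * m - p))"
          by (rule power_mono) auto
        also have "\<dots> \<le> real (Suc L) ^ (2 * m)"
          by (rule power_increasing[OF p]) simp
        finally show "real (card (S n p)) \<le> real (Suc L) ^ (2 * m) * exp (real n * b)"
          by simp
      qed
      finally show ?thesis by (simp add: mult.assoc)
    qed
    show "z n w \<in> X" if "w \<in> W n" for n w
      using z[OF that] by (simp add: P_def)
    show "b < t" by fact
    fix x assume "x \<in> weighted_set X T c L (e / 2) b m s"
    then obtain a where x: "x \<in> X" and a: "\<And>y. y \<in> X \<Longrightarrow> a y < L" "\<And>y. y \<in> X \<Longrightarrow> dist (c (a y)) y < e / 2"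
      and freq: "\<exists>\<^sub>F n in sequentially. (\<Sum>j<n. - ln (s (itinerary T a m ((T ^^ j) x)))) < real n * (real m * b)"
      unfolding weighted_set_def by blast
    have TX: "(T ^^ j) x \<in> X" for j
      using funpow_mem[OF T x] .
    have it_words: "itinerary T a k ((T ^^ j) x) \<in> words L k" for j k
      using funpow_mem[OF T TX] a(1) by (auto simp: words_def itinerary_def)
    show "\<exists>\<^sub>F n in sequentially. \<exists>w\<in>W n. x \<in> bowen_ball X T (z n w) n e"
    proof (rule frequently_elim1[OF freq])
      fix n assume sum: "(\<Sum>j<n. - ln (s (itinerary T a m ((T ^^ j) x)))) < real n * (real m * b)"
      have "0 \<le> - ln (s (itinerary T a m ((T ^^ j) x)))" for j
        using s(1)[OF it_words[of m j]] s_le[OF it_words[of m j]] by simp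
      then obtain p where p: "p < m"
        "(\<Sum>k<n div m. - ln (s (itinerary T a m ((T ^^ (p + k * m)) x)))) < real n * b"
        using ex_residue_class[OF _ sum m] by auto
      let ?w = "itinerary T a (n + m) x"
      have P: "P n ?w x"
        unfolding P_def using x a(2)[OF TX] by (auto simp: itinerary_nth)
      have len: "p + ((n div m) * m + (n + m - (n div m) * m - p)) = n + m"
        using p(1) div_times_less_eq_dividend[of n m] by linarith
      have "take m (drop (p + k * m) ?w) = itinerary T a m ((T ^^ (p + k * m)) x)" if "k < n div m" for k
      proof (rule take_drop_itinerary)
        have "Suc k * m \<le> (n div m) * m"
          using that by (intro mult_le_mono1) auto
        then show "p + k * m + m \<le> n + m"
          using div_times_less_eq_dividend[of n m] p(1) unfolding mult_Suc by linarith
      qed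
      then have "?w \<in> S n p"
        unfolding S_def len using p(2) it_words[of "n + m" 0] by simp
      then have w: "?w \<in> W n"
        unfolding W_def using p(1) P by auto
      have "dist ((T ^^ j) (z n ?w)) ((T ^^ j) x) < e" if "j < n" for j
      proof -
        have "dist (c (?w ! j)) ((T ^^ j) (z n ?w)) < e / 2" "dist (c (?w ! j)) ((T ^^ j) x) < e / 2"
          using z[OF w] P that by (auto simp: P_def)
        then show ?thesis
          by (rule dist_triangle_half_r)
      qed
      then show "\<exists>w\<in>W n. x \<in> bowen_ball X T (z n w) n e"
        using w x by (auto simp: bowen_ball_def)
    qed
  qed
qed

theorem htop_le_if_weak_limits:
  fixes X :: "'a::metric_space set"
  assumes X: "compact X" "T ` X \<subseteq> X" and t: "0 \<le> t"
    and weak: "\<And>x. x \<in> Z \<Longrightarrow> \<exists>G \<mu>. weak_limit X T x G \<mu> \<and> G \<noteq> bot \<and> ks_entropy \<mu> T \<le> ereal t"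
  shows "htop X T Z \<le> ereal t"
  unfolding htop_def
proof (rule SUP_least)
  fix \<epsilon> :: real assume "\<epsilon> \<in> {0<..}"
  then have \<epsilon>: "0 < \<epsilon>" by simp
  \<comment> \<open>Scales: centres are \<open>\<epsilon> / 4\<close>-dense, labels are correct
    within \<open>\<epsilon> / 2\<close>, and the Bowen balls have radius
    \<open>\<epsilon>\<close>.\<close>
  obtain D where D: "finite D" "X \<subseteq> (\<Union>y\<in>D. ball y (\<epsilon> / 2 / 2))"
  proof (rule compactE_image[OF X(1), of X "\<lambda>y. ball y (\<epsilon> / 2 / 2)"])
    show "X \<subseteq> (\<Union>y\<in>X. ball y (\<epsilon> / 2 / 2))"
      using \<epsilon> by (auto intro!: bexI)
  qed auto
  obtain c where "bij_betw c {0..<card D} D"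
    using ex_bij_betw_nat_finite[OF D(1)] by blast
  then have D_eq: "D = c ` {..<card D}"
    by (simp add: bij_betw_def atLeast0LessThan)
  have cover: "X \<subseteq> (\<Union>i<card D. ball (c i) (\<epsilon> / 2 / 2))"
  proof
    fix x assume "x \<in> X"
    then obtain y where y: "y \<in> D" "x \<in> ball y (\<epsilon> / 2 / 2)"
      using D(2) by blast
    then obtain i where "i < card D" "y = c i"
      using D_eq by blast
    then show "x \<in> (\<Union>i<card D. ball (c i) (\<epsilon> / 2 / 2))"
      using y(2) by blast
  qed
  define L where "L = card D"
  show "htop_eps X T Z \<epsilon> \<le> ereal t"
  proof (rule ereal_le_epsilon2)
    fix d :: real assume d: "0 < d"
    define Q where "Q = {(m, s). m \<in> (UNIV :: nat set) \<and> s \<in> PiE (words L m) (\<lambda>_. \<rat> \<inter> {0<..}) \<and> 1 \<le> m \<and>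
        (\<Sum>v\<in>words L m. s v) \<le> (1 :: real)}"
    have "countable (SIGMA m:UNIV. PiE (words L m) (\<lambda>_. \<rat> \<inter> {0<..} :: real set))"
      using finite_words countable_rat by (intro countable_SIGMA countable_PiE) auto
    moreover have "Q \<subseteq> (SIGMA m:UNIV. PiE (words L m) (\<lambda>_. \<rat> \<inter> {0<..}))"
      unfolding Q_def by auto
    ultimately have Q: "countable Q"
      by (rule countable_subset[rotated])
    \<comment> \<open>Half of \<open>d\<close> is spent on the choice of block length and weights;
      the other half is the gap that makes the covering costs decay geometrically.\<close>
    have "Z \<subseteq> (\<Union>(m, s)\<in>Q. weighted_set X T c L (\<epsilon> / 2) (t + d / 2) m s)"
    proof
      fix x assume "x \<in> Z"
      then obtain G \<mu> where wl: "weak_limit X T x G \<mu>" "G \<noteq> bot" "ks_entropy \<mu> T \<le> ereal t"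
        using weak by blast
      interpret weak_limit X T x G \<mu> by fact
      obtain a where a: "coded_weak_limit X T x G \<mu> a L" "\<And>y. y \<in> X \<Longrightarrow> dist (c (a y)) y < \<epsilon> / 2"
        using ex_coding[OF half_gt_zero[OF \<epsilon>] cover[folded L_def]] by blast
      interpret coded_weak_limit X T x G \<mu> a L by fact
      obtain m s where ms: "1 \<le> m" "s \<in> PiE (words L m) (\<lambda>_. \<rat> \<inter> {0<..})" "(\<Sum>v\<in>words L m. s v) \<le> 1"
        and freq: "\<exists>\<^sub>F n in sequentially.
          (\<Sum>j<n. - ln (s (itinerary T a m ((T ^^ j) x)))) < real n * (real m * (t + d / 2))"
        using itinerary_weights[OF wl(2,3) half_gt_zero[OF d]] by blast
      have "x \<in> weighted_set X T c L (\<epsilon> / 2) (t + d / 2) m s"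
        unfolding weighted_set_def using x code_less a(2) freq
        by (intro CollectI conjI exI[of _ a] ballI)
      moreover have "(m, s) \<in> Q"
        unfolding Q_def using ms by simp
      ultimately show "x \<in> (\<Union>(m, s)\<in>Q. weighted_set X T c L (\<epsilon> / 2) (t + d / 2) m s)"
        by (intro UN_I[of "(m, s)"]) simp_all
    qed
    moreover have "bowen_H_n X T (t + d) n (\<Union>(m, s)\<in>Q. weighted_set X T c L (\<epsilon> / 2) (t + d / 2) m s) \<epsilon> = 0" for n
    proof (rule bowen_H_n_countable_UN[OF Q])
      fix k assume "k \<in> Q"
      then obtain m s where k: "k = (m, s)" "1 \<le> m" "s \<in> PiE (words L m) (\<lambda>_. \<rat> \<inter> {0<..})"
        "(\<Sum>v\<in>words L m. s v) \<le> 1"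
        by (auto simp: Q_def)
      show "bowen_H_n X T (t + d) n (case k of (m, s) \<Rightarrow> weighted_set X T c L (\<epsilon> / 2) (t + d / 2) m s) \<epsilon> = 0"
        unfolding k(1) prod.case
        by (rule bowen_H_n_weighted_set[OF X(2) k(2) _ k(4)]) (use PiE_mem[OF k(3)] d in auto)
    qed
    ultimately have "bowen_H_n X T (t + d) n Z \<epsilon> \<le> 0" for n
      using bowen_H_n_mono[of Z "\<Union>(m, s)\<in>Q. weighted_set X T c L (\<epsilon> / 2) (t + d / 2) m s" X T "t + d" n \<epsilon>]
      by (simp only:)
    then have "bowen_H X T (t + d) Z \<epsilon> = 0"
      by (simp add: bowen_H_def)
    then have "htop_eps X T Z \<epsilon> \<le> ereal (t + d)"
      unfolding htop_eps_def using t d by (intro Inf_lower imageI) auto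
    then show "htop_eps X T Z \<epsilon> \<le> ereal t + ereal d"
      by simp
  qed
qed

lemma htop_nonneg: "0 \<le> htop X T Z"
proof -
  have "0 \<le> htop_eps X T Z 1"
    unfolding htop_eps_def by (rule Inf_greatest) auto
  also have "\<dots> \<le> htop X T Z"
    unfolding htop_def by (rule SUP_upper) simp
  finally show ?thesis .
qed

theorem theorem1p1:
  fixes X :: "'a::metric_space set" and T :: "'a \<Rightarrow> 'a"
    and r :: nat and \<Phi> :: "(nat \<Rightarrow> 'a) \<Rightarrow> real" and \<alpha> :: real
  assumes "compact X" and "continuous_on X T" and "T ` X \<subseteq> X"
    and "saturated X T"
    and "1 \<le> r"
    and "continuous_on (PiE {..<r} (\<lambda>_. X)) \<Phi>"
  shows "(level_measures X T r \<Phi> \<alpha> = {} \<longrightarrow> level_set_E X T r \<Phi> \<alpha> = {}) \<and>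
         (level_measures X T r \<Phi> \<alpha> \<noteq> {} \<longrightarrow>
            htop X T (level_set_E X T r \<Phi> \<alpha>) =
              (SUP \<mu>\<in>level_measures X T r \<Phi> \<alpha>. ks_entropy \<mu> T))"
proof (intro conjI impI)
  let ?E = "level_set_E X T r \<Phi> \<alpha>" and ?M = "level_measures X T r \<Phi> \<alpha>"
  have weak: "\<exists>G \<mu>. weak_limit X T x G \<mu> \<and> G \<noteq> bot \<and> \<mu> \<in> ?M" if "x \<in> ?E" for x
    using level_set_E_weak_limit[OF assms(1,2,3,5,6) that] by metis
  show "?E = {}" if "?M = {}"
    using weak that by auto
  assume "?M \<noteq> {}"
  then obtain \<nu> where \<nu>: "\<nu> \<in> ?M" by blast
  have ks: "ks_entropy \<mu> T = htop X T (generic_points X T \<mu>)" if "\<mu> \<in> ?M" for \<mu>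
    using assms(4) that by (simp add: saturated_def level_measures_def)
  let ?t = "SUP \<mu>\<in>?M. ks_entropy \<mu> T"
  show "htop X T ?E = ?t"
  proof (rule antisym)
    show "?t \<le> htop X T ?E"
      by (rule SUP_least)
        (simp add: ks htop_mono generic_points_subset_level_set_E[OF assms(1,2,3,5,6)])
    \<comment> \<open>Saturation identifies \<open>ks_entropy\<close> of a level measure with a
      topological entropy, which is an infimum over nonnegative exponents followed by a supremum. A
      finite \<open>?t\<close> is thus a nonnegative real, as the upper bound requires.\<close>
    have "0 \<le> ?t"
      by (rule SUP_upper2[OF \<nu>]) (simp add: ks[OF \<nu>] htop_nonneg)
    show "htop X T ?E \<le> ?t"
    proof (cases "?t = \<infinity>")
      case False
      then obtain t where t: "?t = ereal t"
        using \<open>0 \<le> ?t\<close> by (cases ?t) auto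
      have "htop X T ?E \<le> ereal t"
      proof (rule htop_le_if_weak_limits[OF assms(1,3)])
        show "0 \<le> t"
          using \<open>0 \<le> ?t\<close> unfolding t by simp
        fix x assume "x \<in> ?E"
        then obtain G \<mu> where "weak_limit X T x G \<mu>" "G \<noteq> bot" "\<mu> \<in> ?M"
          using weak by blast
        moreover from this(3) have "ks_entropy \<mu> T \<le> ereal t"
          unfolding t[symmetric] by (rule SUP_upper)
        ultimately show "\<exists>G \<mu>. weak_limit X T x G \<mu> \<and> G \<noteq> bot \<and> ks_entropy \<mu> T \<le> ereal t"
          by blast
      qed
      then show ?thesis
        by (simp only: t)
    qed simp
  qed
qed

end
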